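(* Let $\alpha>0$, $x_\circ\in\mathbb R^n$, and let $(\mathcal A_{\sigma_i},B)_{i=1}^N$ be ensemble stabilizable. For a given parameter $\sigma\in\mathbb R$, let $(x_\sigma,u_\sigma)$ be the minimizer of $\mathcal J(\mathcal E x,u)$ subject to $\dot x=\mathcal A_\sigma x+Bu$, $x(0)=x_\circ$, with associated adjoint state $p_\sigma$; let $(\mathbf x,u_\varSigma)$ be the minimizer of $\mathcal J(\mathbf x,u)$ subject to $\dot{\mathbf x}=\mathbf A_\varSigma\mathbf x+\mathbf B u$, $\mathbf x(0)=\mathcal E x_\circ$; and let $(x_{\varSigma,\sigma},u_{\varSigma,\sigma})$ be given by $$\dot x_{\varSigma,\sigma}=\mathcal A_\sigma x_{\varSigma,\sigma}-\tfrac1\alpha B\mathbf B^\top\mathbf\Pi_\varSigma\mathcal E x_{\varSigma,\sigma},\quad x_{\varSigma,\sigma}(0)=x_\circ,\qquad u_{\varSigma,\sigma}=-\tfrac1\alpha\mathbf B^\top\mathbf\Pi_\varSigma\mathcal E x_{\varSigma,\sigma}.$$ If $x_{\varSigma,\sigma}\in W((0,+\infty);\mathbb R^n)$, then for each $\vartheta>\|\delta\mathbf A\|$, where $\|\delta\mathbf A\|=\|\mathbf A_\varSigma-\mathbf A_\sigma\|$, $$|\mathcal J(\mathcal E x_\sigma,u_\sigma)-\mathcal J(\mathcal E x_{\varSigma,\sigma},u_{\varSigma,\sigma})|\le\|\delta\mathbf A\|\left(\frac{2}{\vartheta-\|\delta\mathbf A\|}\Bigl(\vartheta^2C_1+\mathcal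 J(\mathbf x,u_\varSigma)\Bigr)+\beta_2^2\|\mathcal E x_{\varSigma,\sigma}\|^2_{L^2((0,+\infty);\mathbb R^{nN})}\right),$$ where, with $\mathcal H_n=L^2((0,+\infty);\mathbb R^n)$, $$C_1=M_s\|x_\sigma\|_{\mathcal H_n}\|p_\sigma\|_{\mathcal H_n}+(1+\sqrt{\alpha N})^2C_0^2,\qquad C_0=\max\bigl\{M_s\|x_\sigma\|_{\mathcal H_n}+\|p_\sigma\|_{\mathcal H_n},\ M_s\|x_\sigma\|_{\mathcal H_n}\beta_2^2\|\mathbf B\|\bigr\}.$$
   Context: Setting: $N\ge2$, $\varSigma=(\sigma_i)_{i=1}^N$ a finite ensemble of parameters; to each parameter $\sigma\in\mathbb R$ is associated a matrix $\mathcal A_\sigma\in\mathbb R^{n\times n}$; $B\in\mathbb R^{n\times m}$. $\mathbf A_\varSigma\in\mathbb R^{nN\times nN}$ is block-diagonal with blocks $\mathcal A_{\sigma_1},\ldots,\mathcal A_{\sigma_N}$; $\mathbf A_\sigma\in\mathbb R^{nN\times nN}$ is block-diagonal with $N$ identical blocks $\mathcal A_\sigma$; $\mathbf B\in\mathbb R^{nN\times m}$ is the stack of $N$ copies of $B$; $\mathcal E:\mathbb R^n\to\mathbb R^{nN}$, $\mathcal E x=\begin{bmatrix}x^\top&\cdots&x^\top\end{bmatrix}^\top$ ($N$ copies). Vector norms are Euclidean, matrix norms are the induced operator norms. A matrix is stable if all its eigenvalues have negative real part. $(\mathcal A_{\sigma_i},B)_{i=1}^N$ is ensemble stabilizable if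 there is $\mathbf K\in\mathbb R^{m\times nN}$ with $\mathbf A_\varSigma+\mathbf B\mathbf K$ stable. $W(I;\mathbb R^M)=\{z\in L^2(I;\mathbb R^M)\mid\dot z\in L^2(I;\mathbb R^M)\}$. Cost: $\mathcal J(\mathbf y,u)=\frac12\int_0^{+\infty}\bigl(\frac1N\|\mathbf y(s)\|^2+\alpha\|u(s)\|^2\bigr)\,ds$ for $\mathbf y$ with values in $\mathbb R^{nN}$ and controls $u\in L^2((0,+\infty);\mathbb R^m)$. Note $\frac1N\|\mathcal E x\|^2=\|x\|^2$. Adjoint state: $p_\sigma\in W((0,+\infty);\mathbb R^n)$ satisfies $\dot p_\sigma=-\mathcal A_\sigma^\top p_\sigma-x_\sigma$ and $u_\sigma=-\frac1\alpha B^\top p_\sigma$ (first-order optimality conditions for $(x_\sigma,u_\sigma)$). $\mathbf\Pi_\varSigma$ is the unique positive definite (symmetric) solution of $\mathbf A_\varSigma^\top\mathbf\Pi_\varSigma+\mathbf\Pi_\varSigma\mathbf A_\varSigma-\frac1\alpha\mathbf\Pi_\varSigma\mathbf B\mathbf B^\top\mathbf\Pi_\varSigma+\frac1N\mathbf 1_{nN}=0$, where $\mathbf 1_{nN}$ is the identity matrix. With $\|\mathbf y\|_{\mathbf\Pi_\varSigma}=\sqrt{\langle\mathbf y,\mathbf\Pi_\varSigma\mathbf y\rangle}$, $\beta_1,\beta_2>0$ are constants such that $\beta_1\|\mathbf y\|\le\|\mathbf y\|_{\mathbf\Pi_\varSigma}\le\beta_2\|\mathbf y\|$ for all $\mathbf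 y\in\mathbb R^{nN}$. $M_s>0$ is a constant such that for all $\mathbf g\in L^2((0,+\infty);\mathbb R^{nN})$ the problem $\dot{\mathbf y}=\mathbf A_\varSigma\mathbf y-\mathbf B\mathbf B^\top\mathbf\Pi_\varSigma\mathbf y+\mathbf g$, $\mathbf y(0)=0$, has a unique solution $\mathbf y\in W((0,+\infty);\mathbb R^{nN})$, and it satisfies $\|\mathbf y\|_{L^2((0,+\infty);\mathbb R^{nN})}\le M_s\|\mathbf g\|_{L^2((0,+\infty);\mathbb R^{nN})}$. *)

theory Defs
  imports "HOL-Analysis.Analysis"
begin

text \<open>
  The space \<open>\<real>\<^sup>n\<^sup>N\<close> is \<open>real ^ ('N \<times> 'n)\<close>: the coordinate \<open>(i, k)\<close> is the \<open>k\<close>-th entry of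
  the \<open>i\<close>-th block. The norm of the library on \<open>real ^ 'k\<close> is Euclidean; on matrices it is not the
  induced one, so operator norms are written with \<^const>\<open>onorm\<close>.
\<close>

definition blockdiag ::
    "('N \<Rightarrow> real ^ 'n ^ 'n) \<Rightarrow> real ^ ('N::finite \<times> 'n::finite) ^ ('N \<times> 'n)"
  where "blockdiag M =
    (\<chi> p q. if fst p = fst q then M (fst p) $ snd p $ snd q else 0)"

definition stack :: "real ^ 'm ^ 'n \<Rightarrow> real ^ 'm::finite ^ ('N::finite \<times> 'n::finite)"
  where "stack B = (\<chi> p. B $ snd p)"

definition replicate_vec :: "real ^ 'n \<Rightarrow> real ^ ('N::finite \<times> 'n::finite)"
  where "replicate_vec x = (\<chi> p. x $ snd p)"

definition op_norm :: "real ^ 'k::finite ^ 'l::finite \<Rightarrow> real"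
  where "op_norm M = onorm ((*v) M)"

definition eigenvalue_of :: "real ^ 'k ^ 'k::finite \<Rightarrow> complex \<Rightarrow> bool"
  where "eigenvalue_of M c \<longleftrightarrow>
    (\<exists>v :: complex ^ 'k. v \<noteq> 0 \<and> (\<chi> i j. complex_of_real (M $ i $ j)) *v v = c *s v)"

definition stable_matrix :: "real ^ 'k ^ 'k::finite \<Rightarrow> bool"
  where "stable_matrix M \<longleftrightarrow> (\<forall>c. eigenvalue_of M c \<longrightarrow> Re c < 0)"

definition ensemble_stabilizable ::
    "('N::finite \<Rightarrow> real ^ 'n ^ 'n) \<Rightarrow> real ^ 'm::finite ^ 'n::finite \<Rightarrow> bool"
  where "ensemble_stabilizable As B \<longleftrightarrow>
    (\<exists>K :: real ^ ('N \<times> 'n) ^ 'm. stable_matrix (blockdiag As + stack B ** K))"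

definition spd_matrix :: "real ^ 'k ^ 'k::finite \<Rightarrow> bool"
  where "spd_matrix M \<longleftrightarrow> transpose M = M \<and> (\<forall>y. y \<noteq> 0 \<longrightarrow> y \<bullet> (M *v y) > 0)"

text \<open>
  Elements of \<open>L\<^sup>2\<close> over \<open>(0, +\<infinity>)\<close> are represented by functions on \<open>real\<close>, whose values outside
  the interval are irrelevant.
\<close>

definition L2_space :: "(real \<Rightarrow> 'a::euclidean_space) set"
  where "L2_space = {f \<in> borel_measurable (lebesgue_on {0<..}).
    integrable (lebesgue_on {0<..}) (\<lambda>t. (norm (f t))\<^sup>2)}"

definition L2_nrm :: "(real \<Rightarrow> 'a::euclidean_space) \<Rightarrow> real"
  where "L2_nrm f = sqrt (LINT t|lebesgue_on {0<..}. (norm (f t))\<^sup>2)"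

text \<open>
  \<open>has_ac_deriv z v\<close>: the function \<open>z\<close> is locally absolutely continuous on \<open>[0, +\<infinity>)\<close> with (almost
  everywhere, equivalently distributional) derivative \<open>v\<close>. Differential equations with \<open>L\<^sup>2\<close> data
  are understood in this sense, and an element of \<open>W\<close> is always represented by its continuous
  version on \<open>[0, +\<infinity>)\<close>, which gives initial values their meaning.
\<close>

definition has_ac_deriv ::
    "(real \<Rightarrow> 'a::euclidean_space) \<Rightarrow> (real \<Rightarrow> 'a) \<Rightarrow> bool"
  where "has_ac_deriv z v \<longleftrightarrow>
    (\<forall>t\<ge>0. set_integrable lebesgue {0..t} v \<and> z t = z 0 + (LINT s:{0..t}|lebesgue. v s))"

definition W_space :: "(real \<Rightarrow> 'a::euclidean_space) set"
  where "W_space = {z \<in> L2_space. \<exists>v \<in> L2_space. has_ac_deriv z v}"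

text \<open>
  The cost is extended-valued: a state driven by an \<open>L\<^sup>2\<close> control need not be square integrable,
  and such a pair has cost \<open>\<infinity>\<close>.
\<close>

definition cost ::
    "real \<Rightarrow> (real \<Rightarrow> real ^ ('N::finite \<times> 'n::finite)) \<Rightarrow> (real \<Rightarrow> real ^ 'm::finite) \<Rightarrow> ennreal"
  where "cost \<alpha> y u =
    (\<integral>\<^sup>+ s. ennreal (1 / real CARD('N) * (norm (y s))\<^sup>2 + \<alpha> * (norm (u s))\<^sup>2)
      \<partial>lebesgue_on {0<..}) / 2"

definition admissible ::
    "real ^ 'k ^ 'k::finite \<Rightarrow> real ^ 'm::finite ^ 'k \<Rightarrow> real ^ 'k \<Rightarrow>
      (real \<Rightarrow> real ^ 'k) \<times> (real \<Rightarrow> real ^ 'm) \<Rightarrow> bool"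
  where "admissible A B x0 = (\<lambda>(x, u). u \<in> L2_space \<and> x 0 = x0 \<and>
    has_ac_deriv x (\<lambda>t. A *v x t + B *v u t))"

end

theory Submission
  imports Defs
begin

text \<open>
  Write \<open>V(y) = \<langle>y, P y\<rangle> / 2\<close>, \<open>J\<^sub>1\<close> for the optimal cost of the single system, \<open>J\<^sub>2\<close> for the cost of
  the feedback pair and \<open>J\<^sub>3\<close> for the optimal ensemble cost. By optimality \<open>J\<^sub>1 \<le> J\<^sub>2\<close>. The Riccati
  equation makes \<open>V\<close> an energy function: along the ensemble optimum it gives \<open>V(E x0) \<le> J\<^sub>3\<close>, and
  along the feedback trajectory, a solution of the ensemble equation perturbed by \<open>- \<delta>A y\<close>, it
  gives \<open>J\<^sub>2 \<le> V(E x0) + \<delta> \<beta>2\<^sup>2 \<parallel>y\<parallel>\<^sup>2\<close>.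

  To bound \<open>J\<^sub>3 - J\<^sub>1\<close>, correct the optimal pair \<open>(z, u)\<close>, \<open>z = E x\<close>, to an admissible pair
  \<open>(z + w, u + v)\<close> of the ensemble problem, where \<open>v = - B\<^sup>T P w\<close> and \<open>w\<close> solves the equation of the
  constant \<open>Ms\<close> with right-hand side \<open>\<delta>A z\<close>. Then \<open>w\<close> and \<open>v\<close> are of order \<open>\<delta>\<close>, and integrating the
  derivative of \<open>\<langle>E p, w\<rangle> / N\<close> turns the part of the cost that is linear in \<open>(w, v)\<close> into
  \<open>\<integral> \<langle>E p, \<delta>A (w + z)\<rangle> / N\<close>. Young's inequality with weight \<open>\<theta>\<close> absorbs the remaining first-order
  term into \<open>\<theta> \<parallel>p\<parallel>\<^sup>2\<close> and \<open>J\<^sub>1 / \<theta>\<close>.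
\<close>

subsection \<open>Absolutely continuous functions\<close>

text \<open>Fubini's theorem for the completed measure needs this. A countable cover by Borel sets
  of finite measure survives completion, which changes the measure of no Borel set.\<close>

lemma sigma_finite_lebesgue: "sigma_finite_measure (lebesgue :: 'a::euclidean_space measure)"
proof
  from lborel.sigma_finite_countable obtain S :: "'a set set"
    where S: "countable S" "S \<subseteq> sets lborel" "\<Union>S = space lborel"
      and fin: "\<forall>a\<in>S. emeasure lborel a \<noteq> \<infinity>"
    by metis
  have "S \<subseteq> sets lebesgue"
    using S(2) sets_completionI_sets by blast
  moreover have "\<forall>a\<in>S. emeasure lebesgue a \<noteq> \<infinity>"
    using fin S(2) by (auto simp del: sets_lborel simp add: subset_iff)
  ultimately show "\<exists>S. countable S \<and> S \<subseteq> sets (lebesgue :: 'a measure) \<and>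
      \<Union>S = space (lebesgue :: 'a measure) \<and> (\<forall>a\<in>S. emeasure lebesgue a \<noteq> \<infinity>)"
    using S(1,3) by (metis space_completion)
qed

text \<open>This is integration by parts in integrated form. By Fubini the left side is the integral
  of \<open>f s * g t\<close> over the plane, which is cut along the diagonal: on the part t \<le> s
  the variable t is integrated first, on the part s < t the variable s.\<close>

lemma lebesgue_integral_product_split:
  fixes f g :: "real \<Rightarrow> real"
  assumes f: "integrable lebesgue f" and g: "integrable lebesgue g"
  shows "integral\<^sup>L lebesgue f * integral\<^sup>L lebesgue g =
    (LINT s|lebesgue. f s * (LINT t:{..s}|lebesgue. g t) + (LINT t:{..s}|lebesgue. f t) * g s)"
    and "integrable lebesgue (\<lambda>s. f s * (LINT t:{..s}|lebesgue. g t))"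
    and "integrable lebesgue (\<lambda>s. (LINT t:{..s}|lebesgue. f t) * g s)"
proof -
  interpret L: sigma_finite_measure "lebesgue :: real measure" by (rule sigma_finite_lebesgue)
  interpret LL: pair_sigma_finite "lebesgue :: real measure" "lebesgue :: real measure" ..
  let ?LL = "(lebesgue :: real measure) \<Otimes>\<^sub>M (lebesgue :: real measure)"
  define k where "k = (\<lambda>(s, t). f s * g t)"
  have [measurable]: "f \<in> borel_measurable lebesgue" "g \<in> borel_measurable lebesgue"
    using f g by auto
  have k: "integrable ?LL k"
    unfolding k_def
  proof (rule LL.Fubini_integrable)
    show "(\<lambda>(s, t). f s * g t) \<in> borel_measurable ?LL" by measurable
    show "integrable lebesgue (\<lambda>s. LINT t|lebesgue. norm (case (s, t) of (s, t) \<Rightarrow> f s * g t))"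
      using f by (simp add: abs_mult)
    show "AE s in lebesgue. integrable lebesgue (\<lambda>t. case (s, t) of (s, t) \<Rightarrow> f s * g t)"
      using g by simp
  qed
  have id: "(\<lambda>x. x) \<in> borel_measurable (lebesgue :: real measure)"
    by (rule measurable_completion) simp
  have [measurable]: "fst \<in> borel_measurable ?LL" "snd \<in> borel_measurable ?LL"
    using measurable_compose[OF measurable_fst id] measurable_compose[OF measurable_snd id] by auto
  have lower: "Measurable.pred ?LL (\<lambda>x. snd x \<le> fst x)" by measurable
  have upper: "Measurable.pred ?LL (\<lambda>x. fst x < snd x)" by measurable
  have k1: "integrable ?LL (\<lambda>x. if snd x \<le> fst x then k x else 0)"
    by (rule Bochner_Integration.integrable_bound[OF k]) (use lower borel_measurable_integrable[OF k] in \<open>auto simp: pred_def intro!: measurable_If\<close>)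
  have k2: "integrable ?LL (\<lambda>x. if fst x < snd x then k x else 0)"
    by (rule Bochner_Integration.integrable_bound[OF k]) (use upper borel_measurable_integrable[OF k] in \<open>auto simp: pred_def intro!: measurable_If\<close>)
  have G: "(LINT t|lebesgue. (if t \<le> s then f s * g t else 0)) = f s * (LINT t:{..s}|lebesgue. g t)" for s
    unfolding set_lebesgue_integral_def integral_mult_right_zero[symmetric]
    by (intro Bochner_Integration.integral_cong) (auto simp: indicator_def)
  \<comment> \<open>The strict triangle produces the open half-line below t; closing it adds only a
    null set and gives both summands the same form.\<close>
  have F: "(LINT s|lebesgue. (if s < t then f s * g t else 0)) = (LINT s:{..t}|lebesgue. f s) * g t" for t
    unfolding set_lebesgue_integral_def integral_mult_left_zero[symmetric]
  proof (rule integral_cong_AE)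
    have "{..<t} \<in> sets lebesgue" "{..t} \<in> sets lebesgue" by auto
    then show "(\<lambda>s. if s < t then f s * g t else 0) \<in> borel_measurable lebesgue"
      by (intro measurable_If) (auto simp: pred_def lessThan_def)
    show "(\<lambda>s. indicator {..t} s *\<^sub>R f s * g t) \<in> borel_measurable lebesgue"
      using \<open>{..t} \<in> sets lebesgue\<close> by measurable
    have "AE s in lebesgue. s \<noteq> t"
      by (rule AE_completion) (rule AE_lborel_singleton)
    then show "AE s in lebesgue. (if s < t then f s * g t else 0) = indicator {..t} s *\<^sub>R f s * g t"
      by eventually_elim (auto simp: indicator_def)
  qed
  show i1: "integrable lebesgue (\<lambda>s. f s * (LINT t:{..s}|lebesgue. g t))"
    using LL.integrable_fst'[OF k1] by (simp add: k_def G cong: if_cong)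
  \<comment> \<open>Exchanging the coordinates brings the upper triangle into a form in which the
    first coordinate is again the outer variable of integration.\<close>
  have swap: "integrable ?LL (\<lambda>x. if snd x < fst x then k (snd x, fst x) else 0)"
    using LL.integrable_product_swap[OF k2] by (simp add: case_prod_unfold)
  show i2: "integrable lebesgue (\<lambda>s. (LINT t:{..s}|lebesgue. f t) * g s)"
    using LL.integrable_fst'[OF swap] by (simp add: k_def F cong: if_cong)
  have "integral\<^sup>L lebesgue f * integral\<^sup>L lebesgue g = integral\<^sup>L ?LL k"
    using LL.integral_fst'[OF k] by (simp add: k_def)
  also have "\<dots> = integral\<^sup>L ?LL (\<lambda>x. (if snd x \<le> fst x then k x else 0) + (if fst x < snd x then k x else 0))"
    by (intro Bochner_Integration.integral_cong) auto
  also have "\<dots> = (LINT s|lebesgue. f s * (LINT t:{..s}|lebesgue. g t))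
      + integral\<^sup>L ?LL (\<lambda>x. if fst x < snd x then k x else 0)"
    by (subst Bochner_Integration.integral_add[OF k1 k2])
      (use LL.integral_fst'[OF k1] in \<open>simp only: k_def G case_prod_conv fst_conv snd_conv\<close>)
  also have "integral\<^sup>L ?LL (\<lambda>x. if fst x < snd x then k x else 0)
      = (LINT s|lebesgue. (LINT t:{..s}|lebesgue. f t) * g s)"
  proof -
    have "integral\<^sup>L ?LL (\<lambda>x. if fst x < snd x then k x else 0)
        = integral\<^sup>L ?LL (\<lambda>x. if snd x < fst x then k (snd x, fst x) else 0)"
      using LL.integral_product_swap[OF borel_measurable_integrable[OF k2]]
      by (simp only: case_prod_unfold fst_conv snd_conv)
    also have "\<dots> = (LINT s|lebesgue. LINT t|lebesgue. (if t < s then f t * g s else 0))"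
      using LL.integral_fst'[OF swap] by (simp only: k_def case_prod_conv fst_conv snd_conv)
    finally show ?thesis by (simp only: F)
  qed
  finally show "integral\<^sup>L lebesgue f * integral\<^sup>L lebesgue g =
    (LINT s|lebesgue. f s * (LINT t:{..s}|lebesgue. g t) + (LINT t:{..s}|lebesgue. f t) * g s)"
    by (simp only: Bochner_Integration.integral_add[OF i1 i2])
qed

lemma has_ac_derivD:
  assumes "has_ac_deriv z v" and "t \<ge> 0"
  shows "set_integrable lebesgue {0..t} v" and "(LINT s:{0..t}|lebesgue. v s) = z t - z 0"
  using assms unfolding has_ac_deriv_def by (blast, metis add_diff_cancel_left')

lemma has_ac_derivI:
  assumes "\<And>t. t \<ge> 0 \<Longrightarrow> set_integrable lebesgue {0..t} v"
    and "\<And>t. t \<ge> 0 \<Longrightarrow> (LINT s:{0..t}|lebesgue. v s) = z t - z 0"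
  shows "has_ac_deriv z v"
  unfolding has_ac_deriv_def using assms by simp

lemma has_ac_deriv_linear:
  assumes z: "has_ac_deriv z v" and f: "bounded_linear f"
  shows "has_ac_deriv (\<lambda>t. f (z t)) (\<lambda>t. f (v t))"
  unfolding has_ac_deriv_def
proof (intro allI impI)
  fix t :: real assume "t \<ge> 0"
  with z have v: "integrable lebesgue (\<lambda>s. indicator {0..t} s *\<^sub>R v s)"
    and zt: "z t = z 0 + (LINT s|lebesgue. indicator {0..t} s *\<^sub>R v s)"
    unfolding has_ac_deriv_def set_integrable_def set_lebesgue_integral_def by blast+
  have fs: "(\<lambda>s. f (indicator {0..t} s *\<^sub>R v s)) = (\<lambda>s. indicator {0..t} s *\<^sub>R f (v s))"
    by (simp only: linear_scale[OF bounded_linear.linear[OF f]])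
  show "set_integrable lebesgue {0..t} (\<lambda>t. f (v t)) \<and>
      f (z t) = f (z 0) + (LINT s:{0..t}|lebesgue. f (v s))"
    using integrable_bounded_linear[OF f v] integral_bounded_linear[OF f v]
    by (simp only: fs zt set_integrable_def set_lebesgue_integral_def linear_add[OF bounded_linear.linear[OF f]])
qed

lemma has_ac_deriv_add:
  assumes "has_ac_deriv z v" "has_ac_deriv y w"
  shows "has_ac_deriv (\<lambda>t. z t + y t) (\<lambda>t. v t + w t)"
proof (rule has_ac_derivI)
  fix t :: real assume "t \<ge> 0"
  note zt = has_ac_derivD[OF assms(1) this] and yt = has_ac_derivD[OF assms(2) this]
  show "set_integrable lebesgue {0..t} (\<lambda>t. v t + w t)"
    using zt(1) yt(1) by (rule set_integral_add)
  show "(LINT s:{0..t}|lebesgue. v s + w s) = z t + y t - (z 0 + y 0)"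
    by (subst set_integral_add(2)[OF zt(1) yt(1)]) (simp add: zt(2) yt(2))
qed

lemma has_ac_deriv_sum:
  assumes "finite I" "\<And>i. i \<in> I \<Longrightarrow> has_ac_deriv (z i) (v i)"
  shows "has_ac_deriv (\<lambda>t. \<Sum>i\<in>I. z i t) (\<lambda>t. \<Sum>i\<in>I. v i t)"
  using assms
proof (induction I)
  case empty
  show ?case by (simp add: has_ac_deriv_def set_integrable_def set_lebesgue_integral_def)
next
  case (insert i I)
  then show ?case by (simp add: has_ac_deriv_add)
qed

lemma has_ac_deriv_continuous_on:
  assumes "has_ac_deriv z v"
  shows "continuous_on {0..t} z"
proof (cases "t \<ge> 0")
  case True
  have v: "v integrable_on {0..t}"
    using has_ac_derivD(1)[OF assms True] by (rule set_lebesgue_integral_eq_integral(1))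
  have "z s = z 0 + integral {0..s} v" if "s \<in> {0..t}" for s
    using has_ac_derivD[OF assms, of s] that set_lebesgue_integral_eq_integral(2)[of "{0..s}" v] by simp
  moreover have "continuous_on {0..t} (\<lambda>s. z 0 + integral {0..s} v)"
    by (intro continuous_intros indefinite_integral_continuous_1 v)
  ultimately show ?thesis by (metis (no_types, lifting) continuous_on_cong)
qed auto

text \<open>Continuity supplies the measurability of states whose square integrability is only
  afterwards deduced from a finite cost.\<close>

lemma has_ac_deriv_continuous_on_Ioi:
  assumes "has_ac_deriv z v"
  shows "continuous_on {0<..} z"
proof (rule continuous_at_imp_continuous_on, rule ballI)
  fix t :: real assume "t \<in> {0<..}"
  then show "isCont z t"
    using has_ac_deriv_continuous_on[OF assms, of "t + 1"]
    by (intro continuous_on_interior[of "{0..t + 1}"]) auto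
qed

text \<open>The product rule without pointwise differentiability: when the derivatives are cut off
  to \<open>{0..T}\<close>, the inner integrals of \<open>lebesgue_integral_product_split\<close>
  are the increments of z and y since time 0.\<close>

lemma has_ac_deriv_mult:
  fixes z y v w :: "real \<Rightarrow> real"
  assumes z: "has_ac_deriv z v" and y: "has_ac_deriv y w"
  shows "has_ac_deriv (\<lambda>t. z t * y t) (\<lambda>t. v t * y t + z t * w t)"
proof (rule has_ac_derivI)
  fix T :: real assume T: "T \<ge> 0"
  define f where "f = (\<lambda>s. indicator {0..T} s *\<^sub>R v s)"
  define g where "g = (\<lambda>s. indicator {0..T} s *\<^sub>R w s)"
  have f: "integrable lebesgue f" and g: "integrable lebesgue g"
    using has_ac_derivD(1)[OF z T] has_ac_derivD(1)[OF y T]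
    by (simp_all add: set_integrable_def f_def g_def)
  have F: "(LINT t:{..s}|lebesgue. f t) = z s - z 0" if "s \<in> {0..T}" for s
  proof -
    have "(LINT t:{..s}|lebesgue. f t) = (LINT t:{0..s}|lebesgue. v t)"
      unfolding set_lebesgue_integral_def f_def
      by (intro Bochner_Integration.integral_cong) (use that in \<open>auto simp: indicator_def\<close>)
    then show ?thesis using has_ac_derivD(2)[OF z, of s] that by simp
  qed
  have G: "(LINT t:{..s}|lebesgue. g t) = y s - y 0" if "s \<in> {0..T}" for s
  proof -
    have "(LINT t:{..s}|lebesgue. g t) = (LINT t:{0..s}|lebesgue. w t)"
      unfolding set_lebesgue_integral_def g_def
      by (intro Bochner_Integration.integral_cong) (use that in \<open>auto simp: indicator_def\<close>)
    then show ?thesis using has_ac_derivD(2)[OF y, of s] that by simp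
  qed
  \<comment> \<open>Outside \<open>{0..T}\<close> the outer factor vanishes, so the increment
    formula may be inserted for every s.\<close>
  have fG: "f s * (LINT t:{..s}|lebesgue. g t) = f s * (y s - y 0)" for s
    using G[of s] by (cases "s \<in> {0..T}") (auto simp: f_def)
  have Fg: "(LINT t:{..s}|lebesgue. f t) * g s = (z s - z 0) * g s" for s
    using F[of s] by (cases "s \<in> {0..T}") (auto simp: g_def)
  note split = lebesgue_integral_product_split[OF f g, unfolded fG Fg]
  have "integral\<^sup>L lebesgue f = z T - z 0" "integral\<^sup>L lebesgue g = y T - y 0"
    using has_ac_derivD(2)[OF z T] has_ac_derivD(2)[OF y T]
    by (simp_all add: f_def g_def set_lebesgue_integral_def)
  note split' = split[unfolded this]
  \<comment> \<open>Writing z and y as increment plus initial value separates the part covered by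
    the splitting from a part that is linear in f and g.\<close>
  have eq: "indicator {0..T} s *\<^sub>R (v s * y s + z s * w s)
      = (f s * (y s - y 0) + (z s - z 0) * g s) + (f s * y 0 + z 0 * g s)" for s
    by (auto simp: f_def g_def indicator_def algebra_simps)
  show "set_integrable lebesgue {0..T} (\<lambda>t. v t * y t + z t * w t)"
    unfolding set_integrable_def eq
    using split'(2,3) f g by (intro Bochner_Integration.integrable_add) auto
  have "(LINT s:{0..T}|lebesgue. v s * y s + z s * w s)
      = (z T - z 0) * (y T - y 0) + ((z T - z 0) * y 0 + z 0 * (y T - y 0))"
    unfolding set_lebesgue_integral_def eq
    using split' f g \<open>integral\<^sup>L lebesgue f = _\<close> \<open>integral\<^sup>L lebesgue g = _\<close>
    by (subst Bochner_Integration.integral_add) auto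
  then show "(LINT s:{0..T}|lebesgue. v s * y s + z s * w s) = z T * y T - z 0 * y 0"
    by (simp add: algebra_simps)
qed

lemma has_ac_deriv_inner:
  fixes z y v w :: "real \<Rightarrow> 'a::euclidean_space"
  assumes "has_ac_deriv z v" and "has_ac_deriv y w"
  shows "has_ac_deriv (\<lambda>t. z t \<bullet> y t) (\<lambda>t. v t \<bullet> y t + z t \<bullet> w t)"
proof -
  have "has_ac_deriv (\<lambda>t. \<Sum>b\<in>Basis. (z t \<bullet> b) * (y t \<bullet> b))
      (\<lambda>t. \<Sum>b\<in>Basis. (v t \<bullet> b) * (y t \<bullet> b) + (z t \<bullet> b) * (w t \<bullet> b))"
    by (intro has_ac_deriv_sum has_ac_deriv_mult has_ac_deriv_linear[OF assms(1)]
        has_ac_deriv_linear[OF assms(2)] bounded_linear_inner_left) auto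
  then show ?thesis by (simp add: euclidean_inner[symmetric] sum.distrib)
qed

text \<open>This removes the boundary term at infinity. Integrability of v gives z a limit
  \<open>L\<close>; if \<open>L\<close> were not 0, then |z| would stay above a positive number from
  some time on, against the integrability of z.\<close>

lemma integral_ac_deriv_integrable:
  fixes z v :: "real \<Rightarrow> real"
  assumes z: "has_ac_deriv z v" and v: "integrable (lebesgue_on {0<..}) v"
    and zi: "integrable (lebesgue_on {0<..}) z"
  shows "(LINT t|lebesgue_on {0<..}. v t) = - z 0"
proof -
  define L where "L = z 0 + (LINT t|lebesgue_on {0<..}. v t)"
  have vi: "integrable lebesgue (\<lambda>t. indicator {0<..} t *\<^sub>R v t)"
    using v by (simp add: integrable_restrict_space)
  have "((\<lambda>T. LINT t|lebesgue. indicator {..T} t *\<^sub>R (indicator {0<..} t *\<^sub>R v t)) \<longlongrightarrow>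
      (LINT t|lebesgue. indicator {0<..} t *\<^sub>R v t)) at_top"
  proof (rule integral_dominated_convergence_at_top[where w = "\<lambda>t. norm (indicator {0<..} t *\<^sub>R v t)"])
    show "integrable lebesgue (\<lambda>t. norm (indicator {0<..} t *\<^sub>R v t))"
      using vi by (rule integrable_norm)
    show "(\<lambda>t. indicator {0<..} t *\<^sub>R v t) \<in> borel_measurable lebesgue"
      using vi by (rule borel_measurable_integrable)
    then show "(\<lambda>t. indicator {..T} t *\<^sub>R (indicator {0<..} t *\<^sub>R v t)) \<in> borel_measurable lebesgue" for T
      by - (rule borel_measurable_scaleR[OF borel_measurable_indicator], simp_all)
    show "AE t in lebesgue. ((\<lambda>T. indicator {..T} t *\<^sub>R (indicator {0<..} t *\<^sub>R v t)) \<longlongrightarrow>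
        indicator {0<..} t *\<^sub>R v t) at_top"
    proof (rule AE_I2)
      fix t :: real
      show "((\<lambda>T. indicator {..T} t *\<^sub>R (indicator {0<..} t *\<^sub>R v t)) \<longlongrightarrow> indicator {0<..} t *\<^sub>R v t) at_top"
        by (rule tendsto_eventually) (use eventually_ge_at_top[of t] in eventually_elim, auto)
    qed
    show "\<forall>\<^sub>F T in at_top. AE t in lebesgue. norm (indicator {..T} t *\<^sub>R (indicator {0<..} t *\<^sub>R v t))
        \<le> norm (indicator {0<..} t *\<^sub>R v t)"
      by (intro always_eventually allI AE_I2) (auto simp: indicator_def)
  qed
  moreover have "(LINT t|lebesgue. indicator {..T} t *\<^sub>R (indicator {0<..} t *\<^sub>R v t)) = z T - z 0"
    if "T \<ge> 0" for T
  proof -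
    have "(LINT t|lebesgue. indicator {..T} t *\<^sub>R (indicator {0<..} t *\<^sub>R v t))
        = (LINT t:{0..T}|lebesgue. v t)"
      unfolding set_lebesgue_integral_def
    proof (rule integral_cong_AE)
      show "(\<lambda>t. indicator {..T} t *\<^sub>R (indicator {0<..} t *\<^sub>R v t)) \<in> borel_measurable lebesgue"
        using borel_measurable_integrable[OF vi]
        by - (rule borel_measurable_scaleR[OF borel_measurable_indicator], simp_all)
      show "(\<lambda>t. indicator {0..T} t *\<^sub>R v t) \<in> borel_measurable lebesgue"
        using has_ac_derivD(1)[OF z that] unfolding set_integrable_def
        by (rule borel_measurable_integrable)
      \<comment> \<open>The integrands can differ only at 0, which lies in \<open>{0..T}\<close> but
        not in \<open>{0<..}\<close>.\<close>
      have "AE t in lebesgue. t \<noteq> (0::real)"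
        by (rule AE_completion) (rule AE_lborel_singleton)
      then show "AE t in lebesgue. indicator {..T} t *\<^sub>R (indicator {0<..} t *\<^sub>R v t)
          = indicator {0..T} t *\<^sub>R v t"
        by eventually_elim (auto simp: indicator_def)
    qed
    then show ?thesis using has_ac_derivD(2)[OF z that] by simp
  qed
  ultimately have "((\<lambda>T. z T - z 0) \<longlongrightarrow> (LINT t|lebesgue. indicator {0<..} t *\<^sub>R v t)) at_top"
    by (elim Lim_transform_eventually) (auto intro: eventually_at_top_linorderI[of 0])
  then have "((\<lambda>T. z 0 + (z T - z 0)) \<longlongrightarrow> L) at_top"
    unfolding L_def by (intro tendsto_intros) (simp add: integral_restrict_space)
  then have lim: "(z \<longlongrightarrow> L) at_top" by simp
  have "L = 0"
  proof (rule ccontr)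
    assume "L \<noteq> 0"
    define e where "e = \<bar>L\<bar> / 2"
    have e: "e > 0" using \<open>L \<noteq> 0\<close> by (simp add: e_def)
    have "\<forall>\<^sub>F T in at_top. \<bar>z T\<bar> > e"
      using order_tendstoD(1)[OF tendsto_rabs[OF lim], of e] \<open>L \<noteq> 0\<close> by (simp add: e_def)
    then obtain T0 where T0: "\<And>T. T \<ge> T0 \<Longrightarrow> \<bar>z T\<bar> > e" by (auto simp: eventually_at_top_linorder)
    \<comment> \<open>The maximum with 1 keeps \<open>{T1..T1 + real n}\<close> inside the open
      half-line, where the integral of |z| is then at least \<open>e * real n\<close> for every
      n.\<close>
    define T1 where "T1 = max T0 1"
    have z_ge: "e \<le> \<bar>z t\<bar>" if "t \<ge> T1" for t
      using T0[of t] that by (auto simp: T1_def)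
    have "e * real n \<le> (LINT t|lebesgue_on {0<..}. \<bar>z t\<bar>)" for n :: nat
    proof -
      have ind: "(\<lambda>t. indicator {0<..} t *\<^sub>R (indicator {T1..T1 + real n} t *\<^sub>R e))
          = (\<lambda>t. indicator {T1..T1 + real n} t *\<^sub>R e)"
        by (auto simp: fun_eq_iff indicator_def T1_def)
      have "e * real n = (LINT t|lebesgue. indicator {T1..T1 + real n} t *\<^sub>R e)" by simp
      also have "\<dots> = (LINT t|lebesgue_on {0<..}. indicator {T1..T1 + real n} t *\<^sub>R e)"
        by (subst integral_restrict_space) (simp_all only: ind, simp)
      also have "\<dots> \<le> (LINT t|lebesgue_on {0<..}. \<bar>z t\<bar>)"
      proof (rule Bochner_Integration.integral_mono)
        have "integrable lebesgue (\<lambda>t. indicator {0<..} t *\<^sub>R (indicator {T1..T1 + real n} t *\<^sub>R e))"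
          unfolding ind by simp
        then show "integrable (lebesgue_on {0<..}) (\<lambda>t. indicator {T1..T1 + real n} t *\<^sub>R e)"
          by (subst integrable_restrict_space) simp_all
        show "integrable (lebesgue_on {0<..}) (\<lambda>t. \<bar>z t\<bar>)" using zi by simp
        show "indicator {T1..T1 + real n} t *\<^sub>R e \<le> \<bar>z t\<bar>" if "t \<in> space (lebesgue_on {0<..})" for t
          using z_ge[of t] by (auto simp: indicator_def)
      qed
      finally show ?thesis .
    qed
    moreover obtain n where "real n > (LINT t|lebesgue_on {0<..}. \<bar>z t\<bar>) / e"
      using reals_Archimedean2 by blast
    ultimately show False using e by (auto simp: field_simps not_less[symmetric])
  qed
  then show ?thesis by (simp add: L_def)
qed

subsection \<open>Square-integrable functions and the cost\<close>

lemma L2_spaceD: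
  assumes "f \<in> L2_space"
  shows "f \<in> borel_measurable (lebesgue_on {0<..})"
    and "integrable (lebesgue_on {0<..}) (\<lambda>t. (norm (f t))\<^sup>2)"
  using assms by (auto simp: L2_space_def)

lemma L2_nrm_power2: "(L2_nrm f)\<^sup>2 = (LINT t|lebesgue_on {0<..}. (norm (f t))\<^sup>2)"
  unfolding L2_nrm_def by (simp add: Bochner_Integration.integral_nonneg)

lemma L2_nrm_nonneg: "L2_nrm f \<ge> 0"
  unfolding L2_nrm_def by (simp add: Bochner_Integration.integral_nonneg)

lemma L2_space_bounded:
  assumes f: "f \<in> borel_measurable (lebesgue_on {0<..})"
    and g: "integrable (lebesgue_on {0<..}) g" and le: "\<And>t. (norm (f t))\<^sup>2 \<le> g t"
  shows "f \<in> L2_space"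
proof -
  have "integrable (lebesgue_on {0<..}) (\<lambda>t. (norm (f t))\<^sup>2)"
  proof (rule Bochner_Integration.integrable_bound[OF g])
    show "(\<lambda>t. (norm (f t))\<^sup>2) \<in> borel_measurable (lebesgue_on {0<..})"
      using f by measurable
    show "AE t in lebesgue_on {0<..}. norm ((norm (f t))\<^sup>2) \<le> norm (g t)"
      using le by (intro AE_I2) (simp add: order.trans[OF le abs_ge_self])
  qed
  then show ?thesis using f by (simp add: L2_space_def)
qed

lemma L2_space_linear:
  assumes f: "f \<in> L2_space" and T: "bounded_linear T"
  shows "(\<lambda>t. T (f t)) \<in> L2_space"
proof -
  obtain K where K: "\<And>x. norm (T x) \<le> norm x * K"
    using bounded_linear.bounded[OF T] by blast
  have "T \<in> borel_measurable borel"
    by (intro borel_measurable_continuous_onI linear_continuous_on T)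
  then have "(\<lambda>t. T (f t)) \<in> borel_measurable (lebesgue_on {0<..})"
    using L2_spaceD(1)[OF f] by (rule measurable_compose[rotated])
  moreover have "integrable (lebesgue_on {0<..}) (\<lambda>t. (norm (f t))\<^sup>2 * K\<^sup>2)"
    using L2_spaceD(2)[OF f] by simp
  moreover have "(norm (T (f t)))\<^sup>2 \<le> (norm (f t))\<^sup>2 * K\<^sup>2" for t
    using power_mono[OF K norm_ge_zero, of "f t" 2] by (simp add: power_mult_distrib)
  ultimately show ?thesis by (rule L2_space_bounded)
qed

text \<open>By the parallelogram law the two sides differ by
  \<open>(norm (a - b))\<^sup>2\<close>.\<close>

lemma norm_add_power2_le:
  fixes a b :: "'a::real_inner"
  shows "(norm (a + b))\<^sup>2 \<le> 2 * (norm a)\<^sup>2 + 2 * (norm b)\<^sup>2"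
  using zero_le_power2[of "norm (a - b)"]
  by (simp add: power2_norm_eq_inner inner_diff inner_add inner_commute)

lemma L2_space_add:
  assumes f: "f \<in> L2_space" and g: "g \<in> L2_space"
  shows "(\<lambda>t. f t + g t) \<in> L2_space"
proof (rule L2_space_bounded)
  show "(\<lambda>t. f t + g t) \<in> borel_measurable (lebesgue_on {0<..})"
    using L2_spaceD(1)[OF f] L2_spaceD(1)[OF g] by measurable
  show "integrable (lebesgue_on {0<..}) (\<lambda>t. 2 * (norm (f t))\<^sup>2 + 2 * (norm (g t))\<^sup>2)"
    using L2_spaceD(2)[OF f] L2_spaceD(2)[OF g] by simp
qed (rule norm_add_power2_le)

lemma L2_space_scaleR: "f \<in> L2_space \<Longrightarrow> (\<lambda>t. c *\<^sub>R f t) \<in> L2_space"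
  by (rule L2_space_linear[OF _ bounded_linear_scaleR_right])

lemma L2_space_minus: "f \<in> L2_space \<Longrightarrow> (\<lambda>t. - f t) \<in> L2_space"
  by (rule L2_space_linear[OF _ bounded_linear_minus[OF bounded_linear_ident]])

lemma L2_space_matrix:
  fixes M :: "real ^ 'k::finite ^ 'l::finite"
  shows "f \<in> L2_space \<Longrightarrow> (\<lambda>t. M *v f t) \<in> L2_space"
  by (rule L2_space_linear[OF _ matrix_vector_mul_bounded_linear])

lemma norm_mult_norm_le: "norm a * norm b \<le> ((norm a)\<^sup>2 + (norm b)\<^sup>2) / 2"
  using zero_le_power2[of "norm a - norm b"] by (simp add: power2_diff)

lemma integrable_L2_norm_mult:
  assumes f: "f \<in> L2_space" and g: "g \<in> L2_space"
  shows "integrable (lebesgue_on {0<..}) (\<lambda>t. norm (f t) * norm (g t))"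
proof (rule Bochner_Integration.integrable_bound)
  show "integrable (lebesgue_on {0<..}) (\<lambda>t. ((norm (f t))\<^sup>2 + (norm (g t))\<^sup>2) / 2)"
    using L2_spaceD(2)[OF f] L2_spaceD(2)[OF g] by simp
  show "(\<lambda>t. norm (f t) * norm (g t)) \<in> borel_measurable (lebesgue_on {0<..})"
    using L2_spaceD(1)[OF f] L2_spaceD(1)[OF g] by measurable
  show "AE t in lebesgue_on {0<..}. norm (norm (f t) * norm (g t))
      \<le> norm (((norm (f t))\<^sup>2 + (norm (g t))\<^sup>2) / 2)"
    by (intro AE_I2) (simp add: norm_mult_norm_le[simplified])
qed

lemma integrable_L2_inner:
  assumes f: "f \<in> L2_space" and g: "g \<in> L2_space"
  shows "integrable (lebesgue_on {0<..}) (\<lambda>t. f t \<bullet> g t)"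
proof (rule Bochner_Integration.integrable_bound[OF integrable_L2_norm_mult[OF f g]])
  show "(\<lambda>t. f t \<bullet> g t) \<in> borel_measurable (lebesgue_on {0<..})"
    using L2_spaceD(1)[OF f] L2_spaceD(1)[OF g] by measurable
qed (simp add: Cauchy_Schwarz_ineq2)

lemma L2_nrm_add_power2:
  assumes f: "f \<in> L2_space" and g: "g \<in> L2_space"
  shows "(L2_nrm (\<lambda>t. f t + g t))\<^sup>2 =
    (L2_nrm f)\<^sup>2 + 2 * (LINT t|lebesgue_on {0<..}. f t \<bullet> g t) + (L2_nrm g)\<^sup>2"
proof -
  have "(norm (f t + g t))\<^sup>2 = (norm (f t))\<^sup>2 + 2 * (f t \<bullet> g t) + (norm (g t))\<^sup>2" for t
    by (simp add: power2_norm_eq_inner inner_add inner_commute)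
  then show ?thesis
    using L2_spaceD(2)[OF f] L2_spaceD(2)[OF g] integrable_L2_inner[OF f g]
    by (simp add: L2_nrm_power2)
qed

lemma L2_nrm_power2_le:
  assumes f: "f \<in> L2_space" and g: "g \<in> L2_space" and le: "\<And>t. norm (f t) \<le> c * norm (g t)"
  shows "(L2_nrm f)\<^sup>2 \<le> c\<^sup>2 * (L2_nrm g)\<^sup>2"
proof -
  have "(LINT t|lebesgue_on {0<..}. (norm (f t))\<^sup>2) \<le> (LINT t|lebesgue_on {0<..}. c\<^sup>2 * (norm (g t))\<^sup>2)"
    using L2_spaceD(2)[OF f] L2_spaceD(2)[OF g] power_mono[OF le norm_ge_zero, of _ 2]
    by (intro Bochner_Integration.integral_mono) (auto simp: power_mult_distrib)
  then show ?thesis by (simp add: L2_nrm_power2)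
qed

lemma cost_eq:
  fixes y :: "real \<Rightarrow> real ^ ('N::finite \<times> 'n::finite)" and u :: "real \<Rightarrow> real ^ 'm::finite"
  assumes y: "y \<in> L2_space" and u: "u \<in> L2_space" and \<alpha>: "\<alpha> \<ge> 0"
  shows "cost \<alpha> y u = ennreal ((1 / real CARD('N) * (L2_nrm y)\<^sup>2 + \<alpha> * (L2_nrm u)\<^sup>2) / 2)"
proof -
  note int = L2_spaceD(2)[OF y] L2_spaceD(2)[OF u]
  have "(\<integral>\<^sup>+ s. ennreal (1 / real CARD('N) * (norm (y s))\<^sup>2 + \<alpha> * (norm (u s))\<^sup>2) \<partial>lebesgue_on {0<..})
      = ennreal (LINT s|lebesgue_on {0<..}. 1 / real CARD('N) * (norm (y s))\<^sup>2 + \<alpha> * (norm (u s))\<^sup>2)"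
    using int \<alpha> by (intro nn_integral_eq_integral) auto
  also have "(LINT s|lebesgue_on {0<..}. 1 / real CARD('N) * (norm (y s))\<^sup>2 + \<alpha> * (norm (u s))\<^sup>2)
      = 1 / real CARD('N) * (L2_nrm y)\<^sup>2 + \<alpha> * (L2_nrm u)\<^sup>2"
    using int by (simp add: L2_nrm_power2)
  finally show ?thesis
    unfolding cost_def using \<alpha> by (simp only: ennreal_divide_numeral zero_le_power2 add_nonneg_nonneg
        mult_nonneg_nonneg zero_le_divide_1_iff of_nat_0_le_iff)
qed

lemma cost_finite_imp_L2:
  fixes y :: "real \<Rightarrow> real ^ ('N::finite \<times> 'n::finite)"
  assumes y: "continuous_on {0<..} y" and \<alpha>: "\<alpha> \<ge> 0" and fin: "cost \<alpha> y u < \<infinity>"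
  shows "y \<in> L2_space"
proof -
  have m: "y \<in> borel_measurable (lebesgue_on {0<..})"
    using y by (intro continuous_imp_measurable_on_sets_lebesgue) auto
  have "(\<integral>\<^sup>+ s. ennreal (1 / real CARD('N) * (norm (y s))\<^sup>2) \<partial>lebesgue_on {0<..})
      \<le> (\<integral>\<^sup>+ s. ennreal (1 / real CARD('N) * (norm (y s))\<^sup>2 + \<alpha> * (norm (u s))\<^sup>2) \<partial>lebesgue_on {0<..})"
    using \<alpha> by (intro nn_integral_mono ennreal_leI) auto
  also have "\<dots> < \<infinity>"
    using fin by (auto simp: cost_def ennreal_divide_eq_top_iff simp flip: less_top)
  finally have "integrable (lebesgue_on {0<..}) (\<lambda>s. 1 / real CARD('N) * (norm (y s))\<^sup>2)"
    using m by (intro integrableI_nonneg) (measurable, auto)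
  then have "integrable (lebesgue_on {0<..}) (\<lambda>s. real CARD('N) * (1 / real CARD('N) * (norm (y s))\<^sup>2))"
    by (rule integrable_mult_right)
  then have "integrable (lebesgue_on {0<..}) (\<lambda>s. (norm (y s))\<^sup>2)" by simp
  then show ?thesis using m by (simp add: L2_space_def)
qed

subsection \<open>The Riccati equation as an energy identity\<close>

lemma norm_mult_vec_le: "norm (M *v x) \<le> op_norm M * norm x"
  unfolding op_norm_def by (rule onorm[OF matrix_vector_mul_bounded_linear])

lemma op_norm_nonneg: "op_norm M \<ge> 0"
  unfolding op_norm_def by (rule onorm_pos_le[OF matrix_vector_mul_bounded_linear])

lemma inner_matrix_vector:
  fixes M :: "real ^ 'k::finite ^ 'l::finite"
  shows "x \<bullet> (M *v y) = (transpose M *v x) \<bullet> y"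
  by (simp add: dot_lmul_matrix)

text \<open>The form of P is nonnegative at y minus its P-orthogonal projection onto z, which is
  \<open>(b / a) *\<^sub>R z\<close>.\<close>

lemma spd_matrix_Cauchy_Schwarz:
  assumes P: "spd_matrix P"
  shows "(y \<bullet> (P *v z))\<^sup>2 \<le> (y \<bullet> (P *v y)) * (z \<bullet> (P *v z))"
proof (cases "z = 0")
  case False
  define a b where "a = z \<bullet> (P *v z)" and "b = y \<bullet> (P *v z)"
  have a: "a > 0" using P False by (simp add: a_def spd_matrix_def)
  have sym: "z \<bullet> (P *v y) = b"
    using P by (simp add: b_def inner_matrix_vector[of z] spd_matrix_def inner_commute)
  have "(y - (b / a) *\<^sub>R z) \<bullet> (P *v (y - (b / a) *\<^sub>R z)) \<ge> 0"
    using P by (cases "y - (b / a) *\<^sub>R z = 0") (auto simp: spd_matrix_def less_imp_le)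
  also have "(y - (b / a) *\<^sub>R z) \<bullet> (P *v (y - (b / a) *\<^sub>R z))
      = y \<bullet> (P *v y) - 2 * (b / a) * b + (b / a)\<^sup>2 * a"
    by (simp add: matrix_vector_mult_diff_distrib matrix_vector_mult_scaleR inner_diff_left
        inner_diff_right sym flip: a_def b_def) (simp add: power2_eq_square algebra_simps)
  also have "\<dots> = y \<bullet> (P *v y) - b\<^sup>2 / a"
    using a by (simp add: power2_eq_square)
  finally show ?thesis using a by (simp add: field_simps flip: a_def b_def)
qed simp

text \<open>A bound on the quadratic form becomes one on P itself, without eigenvalues: with z = P y
  the Cauchy-Schwarz inequality bounds |z|^4 by \<beta>^4 |z|^2 |y|^2, and |z|^2 cancels.\<close>

lemma spd_matrix_norm_le:
  assumes P: "spd_matrix P" and \<beta>: "\<beta> \<ge> 0" "\<And>y. sqrt (y \<bullet> (P *v y)) \<le> \<beta> * norm y"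
  shows "norm (P *v y) \<le> \<beta>\<^sup>2 * norm y"
proof (cases "P *v y = 0")
  case False
  define z where "z = P *v y"
  have z: "norm z > 0" using False by (simp add: z_def)
  have q: "x \<bullet> (P *v x) \<le> \<beta>\<^sup>2 * (norm x)\<^sup>2" for x
    using \<beta>(2)[of x] sqrt_le_D by (fastforce simp: power_mult_distrib)
  have nonneg: "x \<bullet> (P *v x) \<ge> 0" for x
    using P by (cases "x = 0") (auto simp: spd_matrix_def less_imp_le)
  have "(norm z)\<^sup>2 = z \<bullet> (P *v y)"
    by (simp add: z_def power2_norm_eq_inner)
  then have "((norm z)\<^sup>2)\<^sup>2 \<le> (z \<bullet> (P *v z)) * (y \<bullet> (P *v y))"
    using spd_matrix_Cauchy_Schwarz[OF P, of z y] by simp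
  also have "\<dots> \<le> (\<beta>\<^sup>2 * (norm z)\<^sup>2) * (\<beta>\<^sup>2 * (norm y)\<^sup>2)"
    using nonneg q by (intro mult_mono) simp_all
  finally have "(norm z)\<^sup>2 * (norm z)\<^sup>2 \<le> (norm z)\<^sup>2 * (\<beta>\<^sup>2 * norm y)\<^sup>2"
    by (simp add: power2_eq_square algebra_simps)
  then have "(norm z)\<^sup>2 \<le> (\<beta>\<^sup>2 * norm y)\<^sup>2"
    using z by (simp only: mult_le_cancel_left_pos zero_less_power)
  then show ?thesis unfolding z_def[symmetric] by (rule power2_le_imp_le) simp
qed (simp add: \<beta>)

text \<open>Pair the Riccati equation applied to y with y; the symmetry of P makes the two terms
  containing A equal.\<close>

lemma riccati_quadratic_form:
  fixes A P :: "real ^ 'k ^ 'k::finite" and B :: "real ^ 'm::finite ^ 'k"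
  assumes sym: "transpose P = P"
    and ric: "transpose A ** P + P ** A - (1 / \<alpha>) *\<^sub>R (P ** B ** transpose B ** P) + c *\<^sub>R mat 1 = 0"
  shows "2 * ((P *v y) \<bullet> (A *v y)) = 1 / \<alpha> * (norm (transpose B *v (P *v y)))\<^sup>2 - c * (norm y)\<^sup>2"
proof -
  have "y \<bullet> ((transpose A ** P + P ** A - (1 / \<alpha>) *\<^sub>R (P ** B ** transpose B ** P) + c *\<^sub>R mat 1) *v y) = 0"
    by (simp add: ric)
  moreover have "y \<bullet> ((transpose A ** P) *v y) = (P *v y) \<bullet> (A *v y)"
    by (simp only: inner_matrix_vector[of y "transpose A"] transpose_transpose inner_commute
        flip: matrix_vector_mul_assoc)
  moreover have "y \<bullet> ((P ** A) *v y) = (P *v y) \<bullet> (A *v y)"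
    by (simp add: inner_matrix_vector[of y P] sym flip: matrix_vector_mul_assoc)
  moreover have "y \<bullet> ((P ** B ** transpose B ** P) *v y) = (norm (transpose B *v (P *v y)))\<^sup>2"
    by (simp add: inner_matrix_vector[of y P] inner_matrix_vector[of _ B] sym power2_norm_eq_inner
        flip: matrix_vector_mul_assoc)
  ultimately show ?thesis
    by (simp add: matrix_vector_mult_add_rdistrib matrix_vector_mult_diff_rdistrib inner_add_right
        inner_diff_right scaleR_matrix_vector_assoc[symmetric] power2_norm_eq_inner)
qed

text \<open>Completion of the square. In the derivative of <y, P y> the Riccati equation eliminates
  A, and the mixed term in u is absorbed into the squared deviation of u from the feedback
  -(1/\<alpha>) B^T P y. Integration over the half-line leaves only the initial value and the
  contribution of the perturbation g.\<close>

lemma riccati_energy_identity: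
  fixes A P :: "real ^ 'k ^ 'k::finite" and B :: "real ^ 'm::finite ^ 'k"
  assumes \<alpha>: "\<alpha> > 0" and sym: "transpose P = P"
    and ric: "transpose A ** P + P ** A - (1 / \<alpha>) *\<^sub>R (P ** B ** transpose B ** P) + c *\<^sub>R mat 1 = 0"
    and y: "y \<in> L2_space" and u: "u \<in> L2_space" and g: "g \<in> L2_space"
    and ode: "has_ac_deriv y (\<lambda>t. A *v y t + B *v u t + g t)"
  shows "c * (L2_nrm y)\<^sup>2 + \<alpha> * (L2_nrm u)\<^sup>2 =
    y 0 \<bullet> (P *v y 0) + \<alpha> * (L2_nrm (\<lambda>t. u t + (1 / \<alpha>) *\<^sub>R (transpose B *v (P *v y t))))\<^sup>2
      + 2 * (LINT t|lebesgue_on {0<..}. (P *v y t) \<bullet> g t)"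
proof -
  define w where "w = (\<lambda>t. u t + (1 / \<alpha>) *\<^sub>R (transpose B *v (P *v y t)))"
  define v where "v = (\<lambda>t. A *v y t + B *v u t + g t)"
  \<comment> \<open>This is the derivative of <y, P y> after completing the square; its summands are
    integrable one by one.\<close>
  define h where "h = (\<lambda>t. \<alpha> * (norm (w t))\<^sup>2 - \<alpha> * (norm (u t))\<^sup>2 - c * (norm (y t))\<^sup>2
    + 2 * ((P *v y t) \<bullet> g t))"
  have w: "w \<in> L2_space"
    unfolding w_def by (intro L2_space_add L2_space_scaleR L2_space_matrix y u)
  have "has_ac_deriv (\<lambda>t. y t \<bullet> (P *v y t)) (\<lambda>t. v t \<bullet> (P *v y t) + y t \<bullet> (P *v v t))"
    using ode by (intro has_ac_deriv_inner has_ac_deriv_linear[OF _ matrix_vector_mul_bounded_linear])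
      (simp_all only: v_def)
  also have "(\<lambda>t. v t \<bullet> (P *v y t) + y t \<bullet> (P *v v t)) = h"
  proof
    fix t
    have "y t \<bullet> (P *v v t) = v t \<bullet> (P *v y t)"
      by (simp add: inner_matrix_vector[of "y t"] sym inner_commute)
    moreover have "v t \<bullet> (P *v y t) = (P *v y t) \<bullet> (A *v y t)
        + (transpose B *v (P *v y t)) \<bullet> u t + (P *v y t) \<bullet> g t"
      by (simp only: v_def inner_commute[of _ "P *v y t"] inner_add_right inner_matrix_vector[of _ B])
    moreover have "\<alpha> * (norm (w t))\<^sup>2 - \<alpha> * (norm (u t))\<^sup>2
        = 2 * ((transpose B *v (P *v y t)) \<bullet> u t) + 1 / \<alpha> * (norm (transpose B *v (P *v y t)))\<^sup>2"
      using \<alpha> by (simp add: w_def power2_norm_eq_inner inner_add inner_commute field_simps)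
    moreover note riccati_quadratic_form[OF sym ric, of "y t"]
    ultimately show "v t \<bullet> (P *v y t) + y t \<bullet> (P *v v t) = h t"
      by (simp add: h_def)
  qed
  finally have ac: "has_ac_deriv (\<lambda>t. y t \<bullet> (P *v y t)) h" .
  note int = L2_spaceD(2)[OF w] L2_spaceD(2)[OF u] L2_spaceD(2)[OF y]
    integrable_L2_inner[OF L2_space_matrix[OF y, of P] g]
  have "(LINT t|lebesgue_on {0<..}. h t) = - (y 0 \<bullet> (P *v y 0))"
    using int by (intro integral_ac_deriv_integrable[OF ac] integrable_L2_inner L2_space_matrix y)
      (simp add: h_def)
  moreover have "(LINT t|lebesgue_on {0<..}. h t) = \<alpha> * (L2_nrm w)\<^sup>2 - \<alpha> * (L2_nrm u)\<^sup>2 - c * (L2_nrm y)\<^sup>2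
      + 2 * (LINT t|lebesgue_on {0<..}. (P *v y t) \<bullet> g t)"
    using int by (simp add: h_def L2_nrm_power2)
  ultimately show ?thesis by (simp add: w_def)
qed

subsection \<open>Block matrices\<close>

text \<open>With identical blocks the range of \<open>replicate_vec\<close> is invariant, so
  replicated trajectories of the single system solve the equation with \<open>A_rep\<close>.\<close>

lemma blockdiag_mult_replicate_vec:
  fixes M :: "real ^ 'n::finite ^ 'n"
  shows "blockdiag (\<lambda>i::'N::finite. M) *v replicate_vec x = replicate_vec (M *v x)"
proof -
  have "(\<Sum>q\<in>UNIV. (if fst p = fst q then M $ snd p $ snd q else 0) * x $ snd q)
      = (\<Sum>j\<in>UNIV. M $ snd p $ j * x $ j)" for p :: "'N \<times> 'n"
  proof -
    have "(\<Sum>q\<in>UNIV. (if fst p = fst q then M $ snd p $ snd q else 0) * x $ snd q)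
        = (\<Sum>i\<in>UNIV. \<Sum>j\<in>UNIV. (if fst p = i then M $ snd p $ j * x $ j else 0))"
      unfolding UNIV_Times_UNIV[symmetric] sum.cartesian_product
      by (intro sum.cong) auto
    also have "\<dots> = (\<Sum>i\<in>UNIV. if fst p = i then (\<Sum>j\<in>UNIV. M $ snd p $ j * x $ j) else 0)"
      by (intro sum.cong) auto
    finally show ?thesis by simp
  qed
  then show ?thesis
    by (simp add: blockdiag_def replicate_vec_def matrix_vector_mult_def vec_eq_iff)
qed

lemma transpose_blockdiag: "transpose (blockdiag M) = blockdiag (\<lambda>i. transpose (M i))"
  by (auto simp: blockdiag_def transpose_def vec_eq_iff)

lemma stack_mult_vec: "stack B *v u = replicate_vec (B *v u)"
  by (simp add: stack_def replicate_vec_def matrix_vector_mult_def vec_eq_iff)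

lemma inner_replicate_vec:
  fixes x y :: "real ^ 'n::finite"
  shows "(replicate_vec x :: real ^ ('N::finite \<times> 'n)) \<bullet> replicate_vec y = real CARD('N) * (x \<bullet> y)"
proof -
  have "(\<Sum>q\<in>(UNIV :: ('N \<times> 'n) set). x $ snd q * y $ snd q) = (\<Sum>i\<in>(UNIV::'N set). \<Sum>j\<in>UNIV. x $ j * y $ j)"
    unfolding UNIV_Times_UNIV[symmetric] sum.cartesian_product by (intro sum.cong) auto
  then show ?thesis by (simp add: replicate_vec_def inner_vec_def)
qed

lemma norm_replicate_vec_power2:
  fixes x :: "real ^ 'n::finite"
  shows "(norm (replicate_vec x :: real ^ ('N::finite \<times> 'n)))\<^sup>2 = real CARD('N) * (norm x)\<^sup>2"
  by (simp add: power2_norm_eq_inner inner_replicate_vec)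

lemma bounded_linear_replicate_vec:
  "bounded_linear (replicate_vec :: real ^ 'n::finite \<Rightarrow> real ^ ('N::finite \<times> 'n))"
  by (rule linear_conv_bounded_linear[THEN iffD1], rule linearI)
    (simp_all add: replicate_vec_def vec_eq_iff)

lemma L2_nrm_replicate_vec_power2:
  fixes x :: "real \<Rightarrow> real ^ 'n::finite"
  shows "(L2_nrm (\<lambda>t. replicate_vec (x t) :: real ^ ('N::finite \<times> 'n)))\<^sup>2 = real CARD('N) * (L2_nrm x)\<^sup>2"
  by (simp add: L2_nrm_power2 norm_replicate_vec_power2)

lemma L2_space_replicate_vecD:
  fixes x :: "real \<Rightarrow> real ^ 'n::finite"
  assumes x: "x \<in> borel_measurable (lebesgue_on {0<..})"
    and "(\<lambda>t. replicate_vec (x t) :: real ^ ('N::finite \<times> 'n)) \<in> L2_space"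
  shows "x \<in> L2_space"
proof -
  have "integrable (lebesgue_on {0<..}) (\<lambda>t. (1 / real CARD('N)) * (real CARD('N) * (norm (x t))\<^sup>2))"
    using L2_spaceD(2)[OF assms(2)]
    unfolding norm_replicate_vec_power2 by (rule integrable_mult_right)
  then show ?thesis using x by (simp add: L2_space_def)
qed

text \<open>The N equal blocks contribute the same vector each. The proof is by duality: paired with
  v, the transpose moves over as the stack, and the inner product of two replicated vectors carries
  the factor N.\<close>

lemma transpose_stack_mult_replicate_vec:
  fixes B :: "real ^ 'm::finite ^ 'n::finite" and p :: "real ^ 'n"
  shows "transpose (stack B :: real ^ 'm ^ ('N::finite \<times> 'n)) *v replicate_vec p
    = real CARD('N) *\<^sub>R (transpose B *v p)"
proof (rule vector_eq_rdot[THEN iffD1], rule allI)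
  fix v
  have "(transpose (stack B :: real ^ 'm ^ ('N \<times> 'n)) *v replicate_vec p) \<bullet> v
      = (replicate_vec p :: real ^ ('N \<times> 'n)) \<bullet> replicate_vec (B *v v)"
    by (simp only: inner_matrix_vector[symmetric] stack_mult_vec)
  also have "\<dots> = (real CARD('N) *\<^sub>R (transpose B *v p)) \<bullet> v"
    by (simp only: inner_replicate_vec inner_matrix_vector[of p B] inner_scaleR_left)
  finally show "(transpose (stack B :: real ^ 'm ^ ('N \<times> 'n)) *v replicate_vec p) \<bullet> v
      = (real CARD('N) *\<^sub>R (transpose B *v p)) \<bullet> v" .
qed

subsection \<open>Comparison of the costs\<close>

text \<open>With z = M^T y one has |z|^2 = <y, M z>, and one factor |z| cancels. This lets the norm
  of the input matrix bound a feedback that contains its transpose.\<close>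

lemma norm_transpose_mult_vec_le:
  fixes M :: "real ^ 'k::finite ^ 'l::finite"
  shows "norm (transpose M *v y) \<le> op_norm M * norm y"
proof (cases "transpose M *v y = 0")
  case False
  define z where "z = transpose M *v y"
  have "(norm z)\<^sup>2 = y \<bullet> (M *v z)"
    by (simp only: inner_matrix_vector[of y M] z_def power2_norm_eq_inner)
  also have "\<dots> \<le> norm y * (op_norm M * norm z)"
    by (rule order.trans[OF norm_cauchy_schwarz mult_left_mono[OF norm_mult_vec_le norm_ge_zero]])
  finally have "norm z * norm z \<le> (op_norm M * norm y) * norm z"
    by (simp only: power2_eq_square ac_simps)
  then show ?thesis
    unfolding z_def by (rule mult_right_le_imp_le) (use False in \<open>simp only: z_def zero_less_norm_iff not_False_eq_True\<close>)
qed (simp add: op_norm_nonneg)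

text \<open>The left side is the first variation of the cost at (z, u) in direction (w, v). In the
  derivative of <q, w> the drift terms combine to <q, (A - A') w>, the source adds <q, (A - A') z>,
  and \<open>u_q\<close> turns the control term into -\<alpha> <u, v>. The boundary terms vanish
  because w starts at 0 and <q, w> is integrable. For A = A' this is stationarity.\<close>

lemma adjoint_cross_term:
  fixes A A' :: "real ^ 'k ^ 'k::finite" and B :: "real ^ 'm::finite ^ 'k"
  assumes q: "q \<in> L2_space" and z: "z \<in> L2_space" and w: "w \<in> L2_space" "w 0 = 0"
    and u: "u \<in> L2_space" and v: "v \<in> L2_space"
    and q_ode: "has_ac_deriv q (\<lambda>t. - (transpose A' *v q t) - c *\<^sub>R z t)"
    and w_ode: "has_ac_deriv w (\<lambda>t. A *v w t + B *v v t + (A - A') *v z t)"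
    and u_q: "AE t in lebesgue_on {0<..}. transpose B *v q t = - (\<alpha> *\<^sub>R u t)"
  shows "c * (LINT t|lebesgue_on {0<..}. z t \<bullet> w t) + \<alpha> * (LINT t|lebesgue_on {0<..}. u t \<bullet> v t)
    = (LINT t|lebesgue_on {0<..}. q t \<bullet> ((A - A') *v (w t + z t)))"
proof -
  define h where "h = (\<lambda>t. q t \<bullet> ((A - A') *v (w t + z t)) - c * (z t \<bullet> w t)
      + (transpose B *v q t) \<bullet> v t)"
  have "has_ac_deriv (\<lambda>t. q t \<bullet> w t) (\<lambda>t. (- (transpose A' *v q t) - c *\<^sub>R z t) \<bullet> w t
      + q t \<bullet> (A *v w t + B *v v t + (A - A') *v z t))"
    by (rule has_ac_deriv_inner[OF q_ode w_ode])
  also have "(\<lambda>t. (- (transpose A' *v q t) - c *\<^sub>R z t) \<bullet> w t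
      + q t \<bullet> (A *v w t + B *v v t + (A - A') *v z t)) = h"
    by (simp add: h_def fun_eq_iff inner_diff_left inner_diff_right inner_add_right inner_matrix_vector[of _ A']
        inner_matrix_vector[of _ B] matrix_vector_right_distrib
        matrix_vector_mult_diff_rdistrib del: transpose_matrix_vector)
  finally have ac: "has_ac_deriv (\<lambda>t. q t \<bullet> w t) h" .
  note int = integrable_L2_inner[OF q L2_space_matrix[OF L2_space_add[OF w(1) z], of "A - A'"]]
    integrable_L2_inner[OF z w(1)] integrable_L2_inner[OF L2_space_matrix[OF q, of "transpose B"] v]
    integrable_L2_inner[OF u v]
  have "(LINT t|lebesgue_on {0<..}. h t) = 0"
    using integral_ac_deriv_integrable[OF ac _ integrable_L2_inner[OF q w(1)]] int(1-3) w(2)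
    by (simp add: h_def del: transpose_matrix_vector)
  moreover have "(LINT t|lebesgue_on {0<..}. (transpose B *v q t) \<bullet> v t)
      = (LINT t|lebesgue_on {0<..}. - \<alpha> * (u t \<bullet> v t))"
  proof (rule integral_cong_AE)
    show "AE t in lebesgue_on {0<..}. (transpose B *v q t) \<bullet> v t = - \<alpha> * (u t \<bullet> v t)"
      using u_q by eventually_elim simp
  qed (use int in auto)
  ultimately show ?thesis
    using int by (simp add: h_def del: transpose_matrix_vector)
qed

lemma mult_le_Young:
  fixes a b c :: real
  assumes "c > 0"
  shows "a * b \<le> (c * a\<^sup>2 + b\<^sup>2 / c) / 2"
proof -
  have "0 \<le> (c * a - b)\<^sup>2 / c" using assms by simp
  also have "\<dots> = c * a\<^sup>2 + b\<^sup>2 / c - 2 * (a * b)"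
    using assms by (simp add: power2_diff power_mult_distrib field_simps power2_eq_square)
  finally show ?thesis by simp
qed

text \<open>In the application a is \<open>Ms * L2_nrm x\<close>, b is \<open>L2_nrm p\<close>, s is
  the square root of \<alpha> N and X is the square of \<open>L2_nrm x\<close>. Since \<delta> <
  \<theta>, every \<delta>^2 is traded for \<delta> \<theta>; then \<theta> and 1/\<theta> are at
  most 2 \<theta>^2/(\<theta> - \<delta>) and 2/(\<theta> - \<delta>).\<close>

lemma cost_gap_arith:
  fixes a b s \<delta> \<theta> X J\<^sub>1 J\<^sub>3 C0 :: real
  assumes nonneg: "\<delta> \<ge> 0" "a \<ge> 0" "b \<ge> 0" "s \<ge> 0" "J\<^sub>3 \<ge> 0" and \<theta>: "\<theta> > \<delta>" and C0: "a + b \<le> C0"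
    and X: "X / 2 \<le> J\<^sub>1"
    and J3: "J\<^sub>3 \<le> J\<^sub>1 + (\<delta>\<^sup>2 * b\<^sup>2 + \<delta>\<^sup>2 * a\<^sup>2) / 2 + \<delta> / 2 * (\<theta> * b\<^sup>2 + X / \<theta>)
      + (\<delta>\<^sup>2 * a\<^sup>2 + s\<^sup>2 * (\<delta>\<^sup>2 * C0\<^sup>2)) / 2"
  shows "J\<^sub>3 - J\<^sub>1 \<le> \<delta> * (2 / (\<theta> - \<delta>) * (\<theta>\<^sup>2 * (a * b + (1 + s)\<^sup>2 * C0\<^sup>2) + J\<^sub>3))"
    (is "_ \<le> \<delta> * (2 / (\<theta> - \<delta>) * (\<theta>\<^sup>2 * ?C1 + J\<^sub>3))")
proof (cases "J\<^sub>3 \<le> J\<^sub>1")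
  case True
  moreover have "0 \<le> \<delta> * (2 / (\<theta> - \<delta>) * (\<theta>\<^sup>2 * ?C1 + J\<^sub>3))"
    using nonneg \<theta> by (intro mult_nonneg_nonneg add_nonneg_nonneg) auto
  ultimately show ?thesis by linarith
next
  case False
  have \<theta>0: "\<theta> > 0" using nonneg \<theta> by linarith
  have ab: "a\<^sup>2 + b\<^sup>2 \<le> C0\<^sup>2"
  proof -
    have "a\<^sup>2 + b\<^sup>2 \<le> (a + b)\<^sup>2" using nonneg by (simp add: power2_sum)
    also have "\<dots> \<le> C0\<^sup>2" using C0 nonneg by (intro power_mono) auto
    finally show ?thesis .
  qed
  \<comment> \<open>In this case X/2 \<le> \<open>J\<^sub>1\<close> < \<open>J\<^sub>3\<close>, so
    the ensemble cost pays for the term X/\<theta>.\<close>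
  have "\<delta> / 2 * (X / \<theta>) \<le> \<delta> * (1 / \<theta> * J\<^sub>3)"
    using mult_left_mono[of "X / 2" J\<^sub>3 "\<delta> / \<theta>"] X False nonneg \<theta>0 by simp
  also have "\<dots> \<le> \<delta> * (2 / (\<theta> - \<delta>) * J\<^sub>3)"
    using nonneg \<theta> \<theta>0 by (intro mult_left_mono mult_right_mono frac_le) auto
  finally have 1: "\<delta> / 2 * (X / \<theta>) \<le> \<delta> * (2 / (\<theta> - \<delta>) * J\<^sub>3)" .
  have d2: "\<delta>\<^sup>2 * r \<le> \<delta> * \<theta> * r" if "r \<ge> 0" for r
    using that nonneg \<theta> by (auto simp: power2_eq_square intro!: mult_right_mono mult_left_mono)
  have "(\<delta>\<^sup>2 * b\<^sup>2 + \<delta>\<^sup>2 * a\<^sup>2) / 2 + \<delta> / 2 * (\<theta> * b\<^sup>2) + (\<delta>\<^sup>2 * a\<^sup>2 + s\<^sup>2 * (\<delta>\<^sup>2 * C0\<^sup>2)) / 2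
      = \<delta>\<^sup>2 * (b\<^sup>2 / 2 + a\<^sup>2 + s\<^sup>2 * C0\<^sup>2 / 2) + \<delta> * \<theta> * (b\<^sup>2 / 2)"
    by (simp add: algebra_simps add_divide_distrib)
  also have "\<dots> \<le> \<delta> * \<theta> * (b\<^sup>2 / 2 + a\<^sup>2 + s\<^sup>2 * C0\<^sup>2 / 2) + \<delta> * \<theta> * (b\<^sup>2 / 2)"
    by (intro add_right_mono d2) simp
  also have "\<dots> = \<delta> * \<theta> * (a\<^sup>2 + b\<^sup>2 + s\<^sup>2 * C0\<^sup>2 / 2)"
    by (simp add: algebra_simps)
  \<comment> \<open>Expanding (1 + s)^2 gives one copy of \<open>C0\<^sup>2\<close>, which covers
    a^2 + b^2, and one of \<open>s\<^sup>2 * C0\<^sup>2\<close>.\<close>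
  also have "\<dots> \<le> \<delta> * \<theta> * ?C1"
  proof (rule mult_left_mono)
    have "(1 + s)\<^sup>2 * C0\<^sup>2 = C0\<^sup>2 + 2 * (s * C0\<^sup>2) + s\<^sup>2 * C0\<^sup>2"
      by (simp add: power2_sum algebra_simps)
    moreover have "s * C0\<^sup>2 \<ge> 0" "s\<^sup>2 * C0\<^sup>2 \<ge> 0" "a * b \<ge> 0" using nonneg by simp_all
    ultimately show "a\<^sup>2 + b\<^sup>2 + s\<^sup>2 * C0\<^sup>2 / 2 \<le> ?C1" using ab by linarith
    show "0 \<le> \<delta> * \<theta>" using nonneg \<theta>0 by simp
  qed
  also have "\<dots> \<le> \<delta> * (2 / (\<theta> - \<delta>) * (\<theta>\<^sup>2 * ?C1))"
  proof -
    have "\<theta> * (\<theta> - \<delta>) \<le> 2 * \<theta>\<^sup>2"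
      using \<theta>0 nonneg by (simp add: power2_eq_square algebra_simps)
    then have "\<theta> \<le> 2 / (\<theta> - \<delta>) * \<theta>\<^sup>2"
      using \<theta> by (simp add: field_simps)
    then have "\<delta> * \<theta> * ?C1 \<le> \<delta> * (2 / (\<theta> - \<delta>) * \<theta>\<^sup>2) * ?C1"
      using nonneg by (intro mult_right_mono mult_left_mono) auto
    then show ?thesis by (simp only: mult.assoc)
  qed
  finally show ?thesis using J3 1 by (simp add: distrib_left)
qed

theorem corollary3p7:
  fixes A :: "real \<Rightarrow> real ^ 'n ^ 'n::finite"
    and B :: "real ^ 'm::finite ^ 'n"
    and \<sigma>s :: "'N::finite \<Rightarrow> real"
    and \<sigma> \<alpha> \<theta> \<beta>1 \<beta>2 Ms \<delta> C0 C1 :: real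
    and x0 :: "real ^ 'n"
    and A_ens A_rep P :: "real ^ ('N \<times> 'n) ^ ('N \<times> 'n)"
    and B_ens :: "real ^ 'm ^ ('N \<times> 'n)"
    and E :: "real ^ 'n \<Rightarrow> real ^ ('N \<times> 'n)"
    and x p x_fb :: "real \<Rightarrow> real ^ 'n"
    and x_ens :: "real \<Rightarrow> real ^ ('N \<times> 'n)"
    and u u_ens u_fb :: "real \<Rightarrow> real ^ 'm"
  assumes N: "CARD('N) \<ge> 2"
    and alpha: "\<alpha> > 0"
    and A_ens: "A_ens = blockdiag (\<lambda>i. A (\<sigma>s i))"
    and A_rep: "A_rep = blockdiag (\<lambda>i. A \<sigma>)"
    and B_ens: "B_ens = stack B"
    and E: "E = replicate_vec"
    and stabilizable: "ensemble_stabilizable (\<lambda>i. A (\<sigma>s i)) B"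
    and P_spd: "spd_matrix P"
    and P_riccati: "transpose A_ens ** P + P ** A_ens
      - (1 / \<alpha>) *\<^sub>R (P ** B_ens ** transpose B_ens ** P)
      + (1 / real CARD('N)) *\<^sub>R mat 1 = 0"
    and beta: "\<beta>1 > 0" "\<beta>2 > 0"
      "\<And>y. \<beta>1 * norm y \<le> sqrt (y \<bullet> (P *v y)) \<and> sqrt (y \<bullet> (P *v y)) \<le> \<beta>2 * norm y"
    and Ms_pos: "Ms > 0"
    and Ms: "\<And>g :: real \<Rightarrow> real ^ ('N \<times> 'n). g \<in> L2_space \<Longrightarrow>
      (let solves = (\<lambda>y. y \<in> W_space \<and> y 0 = 0 \<and>
         has_ac_deriv y (\<lambda>t. A_ens *v y t - (B_ens ** transpose B_ens ** P) *v y t + g t))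
       in \<exists>y. solves y \<and> (\<forall>z. solves z \<longrightarrow> (\<forall>t\<ge>0. z t = y t)) \<and> L2_nrm y \<le> Ms * L2_nrm g)"
    and opt: "is_arg_min (\<lambda>(x, u). cost \<alpha> (\<lambda>t. E (x t)) u) (admissible (A \<sigma>) B x0) (x, u)"
    and adjoint: "p \<in> W_space"
      "has_ac_deriv p (\<lambda>t. - (transpose (A \<sigma>) *v p t) - x t)"
      "AE t in lebesgue_on {0<..}. u t = - (1 / \<alpha>) *\<^sub>R (transpose B *v p t)"
    and opt_ens: "is_arg_min (\<lambda>(x, u). cost \<alpha> x u) (admissible A_ens B_ens (E x0)) (x_ens, u_ens)"
    and x_fb: "x_fb 0 = x0"
      "has_ac_deriv x_fb
        (\<lambda>t. A \<sigma> *v x_fb t - (1 / \<alpha>) *\<^sub>R (B *v ((transpose B_ens ** P) *v E (x_fb t))))"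
    and u_fb: "AE t in lebesgue_on {0<..}.
      u_fb t = - (1 / \<alpha>) *\<^sub>R ((transpose B_ens ** P) *v E (x_fb t))"
    and x_fb_W: "x_fb \<in> W_space"
    and delta: "\<delta> = op_norm (A_ens - A_rep)"
    and theta: "\<theta> > \<delta>"
    and C0: "C0 = max (Ms * L2_nrm x + L2_nrm p) (Ms * L2_nrm x * \<beta>2\<^sup>2 * op_norm B_ens)"
    and C1: "C1 = Ms * L2_nrm x * L2_nrm p + (1 + sqrt (\<alpha> * real CARD('N)))\<^sup>2 * C0\<^sup>2"
  shows "\<bar>enn2real (cost \<alpha> (\<lambda>t. E (x t)) u) - enn2real (cost \<alpha> (\<lambda>t. E (x_fb t)) u_fb)\<bar>
    \<le> \<delta> * (2 / (\<theta> - \<delta>) * (\<theta>\<^sup>2 * C1 + enn2real (cost \<alpha> x_ens u_ens))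
          + \<beta>2\<^sup>2 * (L2_nrm (\<lambda>t. E (x_fb t)))\<^sup>2)"
proof -

  \<comment> \<open>The drift perturbation and the replicated system\<close>
  define n where "n = real CARD('N)"
  have n: "n > 0" using N by (simp add: n_def)
  define D where "D = A_ens - A_rep"
  define F where "F = transpose B_ens ** P"
  have A_split: "A_ens *v y = A_rep *v y + D *v y" for y
    by (simp add: D_def matrix_vector_mult_diff_rdistrib)
  have \<delta>: "\<delta> \<ge> 0" unfolding delta by (rule op_norm_nonneg)
  have normD: "norm (D *v y) \<le> \<delta> * norm y" for y
    unfolding delta D_def by (rule norm_mult_vec_le)
  have P_sym: "transpose P = P" using P_spd by (simp add: spd_matrix_def)
  have normP: "norm (P *v y) \<le> \<beta>2\<^sup>2 * norm y" for y
    using spd_matrix_norm_le[OF P_spd, of \<beta>2] beta by simp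
  have F_mult: "F *v y = transpose B_ens *v (P *v y)" for y
    by (simp only: F_def matrix_vector_mul_assoc)
  have ric: "transpose A_ens ** P + P ** A_ens
      - (1 / \<alpha>) *\<^sub>R (P ** B_ens ** transpose B_ens ** P) + (1 / n) *\<^sub>R mat 1 = 0"
    using P_riccati by (simp only: n_def)
  have blE: "bounded_linear E" unfolding E by (rule bounded_linear_replicate_vec)
  have E_A: "E (A \<sigma> *v y) = A_rep *v E y" for y
    unfolding E A_rep blockdiag_mult_replicate_vec ..
  have E_B: "E (B *v y) = B_ens *v y" for y
    unfolding E B_ens stack_mult_vec ..

  \<comment> \<open>The feedback pair\<close>
  define y where "y = (\<lambda>t. E (x_fb t))"
  \<comment> \<open>\<open>u_fb\<close> is prescribed only almost everywhere; \<open>uf\<close> is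
    the representative that obeys the feedback law at every time and has the same cost.\<close>
  define uf where "uf = (\<lambda>t. - (1 / \<alpha>) *\<^sub>R (F *v y t))"
  have x_fb_L2: "x_fb \<in> L2_space" using x_fb_W by (simp add: W_space_def)
  have y_L2: "y \<in> L2_space" unfolding y_def by (rule L2_space_linear[OF x_fb_L2 blE])
  have uf_L2: "uf \<in> L2_space" unfolding uf_def by (intro L2_space_scaleR L2_space_matrix y_L2)
  have cost_fb: "cost \<alpha> (\<lambda>t. E (x_fb t)) u_fb = cost \<alpha> y uf"
    unfolding cost_def
    by (intro arg_cong[where f = "\<lambda>c. c / 2"] nn_integral_cong_AE)
      (use u_fb in eventually_elim, simp add: y_def uf_def F_def)
  have ode_fb: "has_ac_deriv x_fb (\<lambda>t. A \<sigma> *v x_fb t + B *v uf t)"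
  proof -
    have "(\<lambda>t. A \<sigma> *v x_fb t - (1 / \<alpha>) *\<^sub>R (B *v ((transpose B_ens ** P) *v E (x_fb t))))
        = (\<lambda>t. A \<sigma> *v x_fb t + B *v uf t)"
      unfolding uf_def y_def F_def
      by (simp only: matrix_vector_mult_scaleR) simp
    then show ?thesis using x_fb(2) by simp
  qed
  have adm_fb: "admissible (A \<sigma>) B x0 (x_fb, uf)"
    using uf_L2 x_fb(1) ode_fb by (simp add: admissible_def)

  \<comment> \<open>The optimal pair of the single system\<close>
  define z where "z = (\<lambda>t. E (x t))"
  have adm: "admissible (A \<sigma>) B x0 (x, u)" and opt_le: "cost \<alpha> z u \<le> cost \<alpha> y uf"
    using opt adm_fb by (auto simp: is_arg_min_def not_less z_def y_def)
  then have u_L2: "u \<in> L2_space" and x_0: "x 0 = x0"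
    and ode_x: "has_ac_deriv x (\<lambda>t. A \<sigma> *v x t + B *v u t)"
    by (simp_all add: admissible_def)
  have ode_z: "has_ac_deriv z (\<lambda>t. A_rep *v z t + B_ens *v u t)"
    using has_ac_deriv_linear[OF ode_x blE]
    by (simp only: z_def E_A E_B linear_add[OF bounded_linear.linear[OF blE]])
  have cost_y: "cost \<alpha> y uf = ennreal ((1 / n * (L2_nrm y)\<^sup>2 + \<alpha> * (L2_nrm uf)\<^sup>2) / 2)"
    unfolding n_def using y_L2 uf_L2 alpha by (intro cost_eq) auto
  \<comment> \<open>The minimal cost is finite by comparison with the feedback pair, whose state is
    square integrable because \<open>x_fb\<close> lies in \<open>W_space\<close>.\<close>
  have z_L2: "z \<in> L2_space"
  proof (rule cost_finite_imp_L2)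
    show "cost \<alpha> z u < \<infinity>" using opt_le by (simp add: cost_y le_less_trans)
  qed (use alpha has_ac_deriv_continuous_on_Ioi[OF ode_z] in auto)
  have x_L2: "x \<in> L2_space"
  proof (rule L2_space_replicate_vecD)
    show "x \<in> borel_measurable (lebesgue_on {0<..})"
      by (intro continuous_imp_measurable_on_sets_lebesgue has_ac_deriv_continuous_on_Ioi[OF ode_x]) simp
    show "(\<lambda>t. replicate_vec (x t) :: real ^ ('N \<times> 'n)) \<in> L2_space"
      using z_L2 by (simp only: z_def E)
  qed
  have cost_z: "cost \<alpha> z u = ennreal ((1 / n * (L2_nrm z)\<^sup>2 + \<alpha> * (L2_nrm u)\<^sup>2) / 2)"
    unfolding n_def using z_L2 u_L2 alpha by (intro cost_eq) auto
  have z_nrm: "(L2_nrm z)\<^sup>2 = n * (L2_nrm x)\<^sup>2"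
    unfolding z_def E n_def by (rule L2_nrm_replicate_vec_power2)

  \<comment> \<open>The correction towards the ensemble equation\<close>
  define g where "g = (\<lambda>t. D *v z t)"
  have g_L2: "g \<in> L2_space" unfolding g_def by (rule L2_space_matrix[OF z_L2])
  obtain w where w_W: "w \<in> W_space" and w_0: "w 0 = 0"
    and ode_w': "has_ac_deriv w (\<lambda>t. A_ens *v w t - (B_ens ** transpose B_ens ** P) *v w t + g t)"
    and w_le: "L2_nrm w \<le> Ms * L2_nrm g"
    using Ms[OF g_L2] unfolding Let_def by blast
  \<comment> \<open>The gain is 1 and not 1/\<alpha>: this is the closed loop to which
    \<open>Ms\<close> refers, and the feedback term of w is then exactly
    \<open>B_ens *v v t\<close>.\<close>
  define v where "v = (\<lambda>t. - (F *v w t))"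
  have w_L2: "w \<in> L2_space" using w_W by (simp add: W_space_def)
  have v_L2: "v \<in> L2_space" unfolding v_def by (intro L2_space_minus L2_space_matrix w_L2)
  have ode_w: "has_ac_deriv w (\<lambda>t. A_ens *v w t + B_ens *v v t + D *v z t)"
  proof -
    have "B_ens *v v t = - ((B_ens ** transpose B_ens ** P) *v w t)" for t
      using matrix_vector_mult_scaleR[of B_ens "-1" "F *v w t"]
      by (simp add: v_def F_def matrix_mul_assoc matrix_vector_mul_assoc)
    then have "A_ens *v w t - (B_ens ** transpose B_ens ** P) *v w t + g t
        = A_ens *v w t + B_ens *v v t + D *v z t" for t
      by (simp add: g_def)
    then show ?thesis using ode_w' by (simp only:)
  qed

  \<comment> \<open>The corrected pair as a competitor in the ensemble problem\<close>
  have adm_zw: "admissible A_ens B_ens (E x0) (\<lambda>t. z t + w t, \<lambda>t. u t + v t)"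
  proof -
    \<comment> \<open>The source \<open>D *v z t\<close> in the equation of w completes
      \<open>A_rep *v z t\<close> to \<open>A_ens *v z t\<close>.\<close>
    have "(\<lambda>t. A_rep *v z t + B_ens *v u t + (A_ens *v w t + B_ens *v v t + D *v z t))
        = (\<lambda>t. A_ens *v (z t + w t) + B_ens *v (u t + v t))"
      by (simp add: matrix_vector_right_distrib A_split[of "z _"] algebra_simps)
    then have "has_ac_deriv (\<lambda>t. z t + w t) (\<lambda>t. A_ens *v (z t + w t) + B_ens *v (u t + v t))"
      using has_ac_deriv_add[OF ode_z ode_w] by (simp only:)
    then show ?thesis
      using L2_space_add[OF u_L2 v_L2] by (simp add: admissible_def z_def x_0 w_0)
  qed
  have opt_ens_le: "cost \<alpha> x_ens u_ens \<le> cost \<alpha> (\<lambda>t. z t + w t) (\<lambda>t. u t + v t)"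
    and adm_ens: "admissible A_ens B_ens (E x0) (x_ens, u_ens)"
    using opt_ens adm_zw by (auto simp: is_arg_min_def not_less)
  have u_ens_L2: "u_ens \<in> L2_space" and x_ens_0: "x_ens 0 = E x0"
    and ode_ens: "has_ac_deriv x_ens (\<lambda>t. A_ens *v x_ens t + B_ens *v u_ens t)"
    using adm_ens by (simp_all add: admissible_def)
  have cost_zw: "cost \<alpha> (\<lambda>t. z t + w t) (\<lambda>t. u t + v t)
      = ennreal ((1 / n * (L2_nrm (\<lambda>t. z t + w t))\<^sup>2 + \<alpha> * (L2_nrm (\<lambda>t. u t + v t))\<^sup>2) / 2)"
    unfolding n_def using z_L2 w_L2 u_L2 v_L2 alpha by (intro cost_eq L2_space_add) auto
  have x_ens_L2: "x_ens \<in> L2_space"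
  proof (rule cost_finite_imp_L2)
    show "cost \<alpha> x_ens u_ens < \<infinity>" using opt_ens_le by (simp add: cost_zw le_less_trans)
  qed (use alpha has_ac_deriv_continuous_on_Ioi[OF ode_ens] in auto)
  have cost_ens: "cost \<alpha> x_ens u_ens = ennreal ((1 / n * (L2_nrm x_ens)\<^sup>2 + \<alpha> * (L2_nrm u_ens)\<^sup>2) / 2)"
    unfolding n_def using x_ens_L2 u_ens_L2 alpha by (intro cost_eq) auto

  \<comment> \<open>The costs as real numbers\<close>
  define J1 where "J1 = enn2real (cost \<alpha> z u)"
  define J2 where "J2 = enn2real (cost \<alpha> y uf)"
  define J3 where "J3 = enn2real (cost \<alpha> x_ens u_ens)"
  have J_nonneg: "0 \<le> (1 / n * (L2_nrm f)\<^sup>2 + \<alpha> * (L2_nrm h)\<^sup>2) / 2"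
    for f :: "real \<Rightarrow> real ^ ('N \<times> 'n)" and h :: "real \<Rightarrow> real ^ 'm"
    using n alpha by simp
  have J1: "J1 = (1 / n * (L2_nrm z)\<^sup>2 + \<alpha> * (L2_nrm u)\<^sup>2) / 2"
    unfolding J1_def cost_z by (rule enn2real_ennreal[OF J_nonneg])
  have J2: "J2 = (1 / n * (L2_nrm y)\<^sup>2 + \<alpha> * (L2_nrm uf)\<^sup>2) / 2"
    unfolding J2_def cost_y by (rule enn2real_ennreal[OF J_nonneg])
  have J3: "J3 = (1 / n * (L2_nrm x_ens)\<^sup>2 + \<alpha> * (L2_nrm u_ens)\<^sup>2) / 2"
    unfolding J3_def cost_ens by (rule enn2real_ennreal[OF J_nonneg])
  have J12: "J1 \<le> J2"
    using opt_le unfolding cost_y cost_z J1 J2 by (rule ennreal_le_iff[OF J_nonneg, THEN iffD1])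
  have J3_le: "J3 \<le> (1 / n * (L2_nrm (\<lambda>t. z t + w t))\<^sup>2 + \<alpha> * (L2_nrm (\<lambda>t. u t + v t))\<^sup>2) / 2"
    using opt_ens_le unfolding cost_ens cost_zw J3 by (rule ennreal_le_iff[OF J_nonneg, THEN iffD1])

  \<comment> \<open>Energy estimates from the Riccati equation\<close>
  define V where "V = E x0 \<bullet> (P *v E x0)"
  \<comment> \<open>\<open>V\<close> carries no factor 1/2. Without perturbation the energy identity
    has one further term, the nonnegative squared deviation from the feedback, which is
    dropped.\<close>
  have V_le: "V \<le> 2 * J3"
  proof -
    have "1 / n * (L2_nrm x_ens)\<^sup>2 + \<alpha> * (L2_nrm u_ens)\<^sup>2 = x_ens 0 \<bullet> (P *v x_ens 0)
        + \<alpha> * (L2_nrm (\<lambda>t. u_ens t + (1 / \<alpha>) *\<^sub>R (transpose B_ens *v (P *v x_ens t))))\<^sup>2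
        + 2 * (LINT t|lebesgue_on {0<..}. (P *v x_ens t) \<bullet> 0)"
      by (rule riccati_energy_identity[OF alpha P_sym ric x_ens_L2 u_ens_L2])
        (use ode_ens in \<open>simp_all add: L2_space_def\<close>)
    then show ?thesis using alpha by (simp add: J3 V_def x_ens_0)
  qed
  have J2_le: "J2 \<le> V / 2 + \<delta> * (\<beta>2\<^sup>2 * (L2_nrm y)\<^sup>2)"
  proof -
    have ode_y: "has_ac_deriv y (\<lambda>t. A_ens *v y t + B_ens *v uf t + - (D *v y t))"
      using has_ac_deriv_linear[OF ode_fb blE]
      by (simp add: y_def E_A E_B linear_add[OF bounded_linear.linear[OF blE]] A_split)
    have Dy_L2: "(\<lambda>t. - (D *v y t)) \<in> L2_space"
      by (intro L2_space_minus L2_space_matrix y_L2)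
    \<comment> \<open>\<open>uf\<close> is the Riccati feedback itself, so the completed square
      vanishes and only the perturbation term remains to be estimated.\<close>
    have "(\<lambda>t. uf t + (1 / \<alpha>) *\<^sub>R (transpose B_ens *v (P *v y t))) = (\<lambda>t. 0)"
      by (simp only: uf_def F_mult scaleR_minus_left add.left_inverse)
    moreover have "L2_nrm (\<lambda>t. 0 :: real ^ 'm) = 0" by (simp add: L2_nrm_def)
    moreover have "y 0 = E x0" by (simp only: y_def x_fb(1))
    ultimately have "1 / n * (L2_nrm y)\<^sup>2 + \<alpha> * (L2_nrm uf)\<^sup>2
        = V + 2 * (LINT t|lebesgue_on {0<..}. (P *v y t) \<bullet> (- (D *v y t)))"
      using riccati_energy_identity[OF alpha P_sym ric y_L2 uf_L2 Dy_L2 ode_y]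
      by (simp only: V_def zero_power2 mult_zero_right add_0_right)
    moreover have "(LINT t|lebesgue_on {0<..}. (P *v y t) \<bullet> (- (D *v y t)))
        \<le> (LINT t|lebesgue_on {0<..}. \<delta> * \<beta>2\<^sup>2 * (norm (y t))\<^sup>2)"
    proof (rule Bochner_Integration.integral_mono)
      show "(P *v y t) \<bullet> (- (D *v y t)) \<le> \<delta> * \<beta>2\<^sup>2 * (norm (y t))\<^sup>2" for t
      proof -
        have "(P *v y t) \<bullet> (- (D *v y t)) \<le> norm (P *v y t) * norm (D *v y t)"
          using norm_cauchy_schwarz[of "P *v y t" "- (D *v y t)"] by simp
        also have "\<dots> \<le> (\<beta>2\<^sup>2 * norm (y t)) * (\<delta> * norm (y t))"
          by (intro mult_mono normP normD) auto
        finally show ?thesis by (simp add: power2_eq_square ac_simps)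
      qed
      show "integrable (lebesgue_on {0<..}) (\<lambda>t. (P *v y t) \<bullet> (- (D *v y t)))"
        by (rule integrable_L2_inner[OF L2_space_matrix[OF y_L2] Dy_L2])
      show "integrable (lebesgue_on {0<..}) (\<lambda>t. \<delta> * \<beta>2\<^sup>2 * (norm (y t))\<^sup>2)"
        by (rule integrable_mult_right[OF L2_spaceD(2)[OF y_L2]])
    qed
    moreover have "(LINT t|lebesgue_on {0<..}. \<delta> * \<beta>2\<^sup>2 * (norm (y t))\<^sup>2) = \<delta> * (\<beta>2\<^sup>2 * (L2_nrm y)\<^sup>2)"
      unfolding L2_nrm_power2 integral_mult_right_zero mult.assoc ..
    moreover have "2 * J2 = 1 / n * (L2_nrm y)\<^sup>2 + \<alpha> * (L2_nrm uf)\<^sup>2" by (simp add: J2)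
    ultimately show ?thesis by linarith
  qed

  \<comment> \<open>The adjoint state and the first variation of the cost\<close>
  have p_L2: "p \<in> L2_space" using adjoint(1) by (simp add: W_space_def)
  \<comment> \<open>The factor 1/N matches the weight of the state in the cost: the adjoint equation
    gets the source -z/N, and the N copies in \<open>transpose B_ens *v q t\<close> add up to
    \<open>transpose B *v p t\<close>.\<close>
  define q where "q = (\<lambda>t. (1 / n) *\<^sub>R E (p t))"
  have blq: "bounded_linear (\<lambda>s. (1 / n) *\<^sub>R E s)"
    by (intro bounded_linear_scaleR_right[THEN bounded_linear_compose] blE)
  have q_L2: "q \<in> L2_space" unfolding q_def by (rule L2_space_linear[OF p_L2 blq])
  have q_nrm: "n * (L2_nrm q)\<^sup>2 = (L2_nrm p)\<^sup>2"
  proof -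
    have "(L2_nrm (\<lambda>t. E (p t)))\<^sup>2 = n * (L2_nrm p)\<^sup>2"
      unfolding E n_def by (rule L2_nrm_replicate_vec_power2)
    moreover have "(L2_nrm q)\<^sup>2 = (1 / n)\<^sup>2 * (L2_nrm (\<lambda>t. E (p t)))\<^sup>2"
      unfolding q_def L2_nrm_power2 norm_scaleR power_mult_distrib power2_abs integral_mult_right_zero ..
    ultimately show ?thesis using n by (simp add: field_simps power2_eq_square[of n])
  qed
  have ode_q: "has_ac_deriv q (\<lambda>t. - (transpose A_rep *v q t) - (1 / n) *\<^sub>R z t)"
  proof -
    have E_AT: "E (transpose (A \<sigma>) *v s) = transpose A_rep *v E s" for s
      unfolding E A_rep transpose_blockdiag blockdiag_mult_replicate_vec ..
    have "(1 / n) *\<^sub>R E (- (transpose (A \<sigma>) *v p t) - x t)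
        = - (transpose A_rep *v q t) - (1 / n) *\<^sub>R z t" for t
      by (simp only: linear_diff[OF bounded_linear.linear[OF blE]] linear_neg[OF bounded_linear.linear[OF blE]]
          E_AT q_def z_def matrix_vector_mult_scaleR scaleR_diff_right scaleR_minus_right)
    then show ?thesis
      using has_ac_deriv_linear[OF adjoint(2) blq] by (simp only: q_def)
  qed
  have u_q: "AE t in lebesgue_on {0<..}. transpose B_ens *v q t = - (\<alpha> *\<^sub>R u t)"
    using adjoint(3)
  proof eventually_elim
    case (elim t)
    have "transpose B_ens *v q t = (1 / n) *\<^sub>R (n *\<^sub>R (transpose B *v p t))"
      unfolding q_def matrix_vector_mult_scaleR E B_ens n_def transpose_stack_mult_replicate_vec ..
    then show ?case using n alpha elim by simp
  qed
  define T where "T = (LINT t|lebesgue_on {0<..}. q t \<bullet> (D *v (w t + z t)))"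
  have cross: "1 / n * (LINT t|lebesgue_on {0<..}. z t \<bullet> w t)
      + \<alpha> * (LINT t|lebesgue_on {0<..}. u t \<bullet> v t) = T"
    using adjoint_cross_term[OF q_L2 z_L2 w_L2 w_0 u_L2 v_L2 ode_q ode_w[unfolded D_def] u_q]
    by (simp only: T_def D_def)
  have J3_J1: "J3 \<le> J1 + T + (1 / n * (L2_nrm w)\<^sup>2 + \<alpha> * (L2_nrm v)\<^sup>2) / 2"
    using J3_le unfolding L2_nrm_add_power2[OF z_L2 w_L2] L2_nrm_add_power2[OF u_L2 v_L2] J1 cross[symmetric]
    by (simp add: algebra_simps add_divide_distrib)

  \<comment> \<open>Bounds for the linear and quadratic terms\<close>
  have T_le: "T \<le> (\<delta>\<^sup>2 * (n * (L2_nrm q)\<^sup>2) + 1 / n * (L2_nrm w)\<^sup>2) / 2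
      + \<delta> / 2 * (\<theta> * (n * (L2_nrm q)\<^sup>2) + 1 / n * (L2_nrm z)\<^sup>2 / \<theta>)"
  proof -
    have \<theta>n: "\<theta> * n > 0" using theta \<delta> n by simp
    \<comment> \<open>Young's inequality is used twice. Against w, itself of order \<delta>, the
      factor \<delta> is squared together with q and the weight is n; against z it stays outside and
      the weight is \<open>\<theta> * n\<close>. The factor n turns norms of q, w and z into the
      normalized ones of the cost.\<close>
    let ?b = "\<lambda>t. (n * \<delta>\<^sup>2 * (norm (q t))\<^sup>2 + (norm (w t))\<^sup>2 / n) / 2
      + \<delta> * ((\<theta> * n * (norm (q t))\<^sup>2 + (norm (z t))\<^sup>2 / (\<theta> * n)) / 2)"
    note int = L2_spaceD(2)[OF q_L2] L2_spaceD(2)[OF w_L2] L2_spaceD(2)[OF z_L2]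
    have "T \<le> (LINT t|lebesgue_on {0<..}. ?b t)"
      unfolding T_def
    proof (rule Bochner_Integration.integral_mono)
      show "q t \<bullet> (D *v (w t + z t)) \<le> ?b t" for t
      proof -
        have "q t \<bullet> (D *v (w t + z t)) \<le> norm (q t) * (\<delta> * norm (w t + z t))"
          by (rule order.trans[OF norm_cauchy_schwarz mult_left_mono[OF normD norm_ge_zero]])
        also have "\<dots> \<le> norm (q t) * (\<delta> * (norm (w t) + norm (z t)))"
          by (intro mult_left_mono norm_triangle_ineq \<delta> norm_ge_zero)
        also have "\<dots> = (\<delta> * norm (q t)) * norm (w t) + \<delta> * (norm (q t) * norm (z t))"
          by (simp add: algebra_simps)
        also have "\<dots> \<le> ?b t"
        proof (rule add_mono)
          show "\<delta> * norm (q t) * norm (w t) \<le> (n * \<delta>\<^sup>2 * (norm (q t))\<^sup>2 + (norm (w t))\<^sup>2 / n) / 2"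
            using mult_le_Young[OF n, of "\<delta> * norm (q t)" "norm (w t)"]
            by (simp only: power_mult_distrib mult.assoc)
        qed (rule mult_left_mono[OF mult_le_Young[OF \<theta>n] \<delta>])
        finally show ?thesis .
      qed
    qed (use int integrable_L2_inner[OF q_L2 L2_space_matrix[OF L2_space_add[OF w_L2 z_L2]]] in auto)
    also have "\<dots> = (\<delta>\<^sup>2 * (n * (L2_nrm q)\<^sup>2) + 1 / n * (L2_nrm w)\<^sup>2) / 2
      + \<delta> / 2 * (\<theta> * (n * (L2_nrm q)\<^sup>2) + 1 / n * (L2_nrm z)\<^sup>2 / \<theta>)"
      using int by (simp add: L2_nrm_power2 mult.assoc mult.commute mult.left_commute)
    finally show ?thesis .
  qed

  define a where "a = Ms * L2_nrm x"
  have a: "a \<ge> 0" using Ms_pos by (simp add: a_def L2_nrm_nonneg)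
  have w_bound: "1 / n * (L2_nrm w)\<^sup>2 \<le> \<delta>\<^sup>2 * a\<^sup>2"
  proof -
    have "(L2_nrm w)\<^sup>2 \<le> Ms\<^sup>2 * (L2_nrm g)\<^sup>2"
      using power_mono[OF w_le L2_nrm_nonneg, of 2] by (simp add: power_mult_distrib)
    also have "\<dots> \<le> Ms\<^sup>2 * (\<delta>\<^sup>2 * (L2_nrm z)\<^sup>2)"
      by (intro mult_left_mono L2_nrm_power2_le g_L2 z_L2) (simp_all add: g_def normD)
    finally show ?thesis
      using n by (simp add: z_nrm a_def field_simps)
  qed
  have v_bound: "\<alpha> * (L2_nrm v)\<^sup>2 \<le> (sqrt (\<alpha> * n))\<^sup>2 * (\<delta>\<^sup>2 * C0\<^sup>2)"
  proof -
    \<comment> \<open>\<open>b\<close> bounds the feedback operator \<open>F\<close>, and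
      \<open>a * b\<close> is the second entry of the maximum in \<open>C0\<close>.\<close>
    define b where "b = op_norm B_ens * \<beta>2\<^sup>2"
    have b: "b \<ge> 0" by (simp add: b_def op_norm_nonneg)
    have "norm (v t) \<le> b * norm (w t)" for t
    proof -
      have "norm (v t) \<le> op_norm B_ens * norm (P *v w t)"
        unfolding v_def norm_minus_cancel F_mult by (rule norm_transpose_mult_vec_le)
      also have "\<dots> \<le> op_norm B_ens * (\<beta>2\<^sup>2 * norm (w t))"
        by (intro mult_left_mono normP op_norm_nonneg)
      finally show ?thesis by (simp add: b_def mult.assoc)
    qed
    then have "(L2_nrm v)\<^sup>2 \<le> b\<^sup>2 * (L2_nrm w)\<^sup>2"
      by (rule L2_nrm_power2_le[OF v_L2 w_L2])
    also have "\<dots> \<le> b\<^sup>2 * (n * (\<delta>\<^sup>2 * a\<^sup>2))"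
      using w_bound n by (intro mult_left_mono) (simp_all add: field_simps)
    also have "\<dots> = n * \<delta>\<^sup>2 * (a * b)\<^sup>2" by (simp add: power_mult_distrib)
    also have "\<dots> \<le> n * \<delta>\<^sup>2 * C0\<^sup>2"
    proof (intro mult_left_mono power_mono)
      have "a * b = Ms * L2_nrm x * \<beta>2\<^sup>2 * op_norm B_ens" by (simp only: a_def b_def ac_simps)
      then show "a * b \<le> C0" unfolding C0 by (simp only: max.cobounded2)
    qed (use n a b in simp_all)
    finally show ?thesis
      using alpha n mult_left_mono[of "(L2_nrm v)\<^sup>2" "n * \<delta>\<^sup>2 * C0\<^sup>2" \<alpha>] by (simp add: mult.assoc)
  qed

  \<comment> \<open>Assembling the estimate\<close>
  have "J3 - J1 \<le> \<delta> * (2 / (\<theta> - \<delta>) * (\<theta>\<^sup>2 * (a * L2_nrm p + (1 + sqrt (\<alpha> * n))\<^sup>2 * C0\<^sup>2) + J3))"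
  proof (rule cost_gap_arith[where X = "(L2_nrm x)\<^sup>2"])
    show "(L2_nrm x)\<^sup>2 / 2 \<le> J1" using n alpha by (simp add: J1 z_nrm)
    show "J3 \<le> J1 + (\<delta>\<^sup>2 * (L2_nrm p)\<^sup>2 + \<delta>\<^sup>2 * a\<^sup>2) / 2 + \<delta> / 2 * (\<theta> * (L2_nrm p)\<^sup>2 + (L2_nrm x)\<^sup>2 / \<theta>)
        + (\<delta>\<^sup>2 * a\<^sup>2 + (sqrt (\<alpha> * n))\<^sup>2 * (\<delta>\<^sup>2 * C0\<^sup>2)) / 2"
    proof -
      have zx: "1 / n * (L2_nrm z)\<^sup>2 = (L2_nrm x)\<^sup>2" using n by (simp add: z_nrm)
      \<comment> \<open>The bound c for the norm of w is spent twice: on the remainder from Young's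
        inequality and on the quadratic part of the cost.\<close>
      have combine: "j \<le> i + (d + c) / 2 + k + (c + e) / 2"
        if "j \<le> i + t + (r + s) / 2" "t \<le> (d + r) / 2 + k" "r \<le> c" "s \<le> e"
        for c d e i j k r s t :: real
        using that by argo
      show ?thesis by (rule combine[OF J3_J1 T_le[unfolded q_nrm zx] w_bound v_bound])
    qed
    show "J3 \<ge> 0" unfolding J3_def by simp
    show "a + L2_nrm p \<le> C0" by (simp add: C0 a_def)
  qed (use \<delta> theta a n alpha in \<open>simp_all add: L2_nrm_nonneg\<close>)
  then have gap: "J3 - J1 \<le> \<delta> * (2 / (\<theta> - \<delta>) * (\<theta>\<^sup>2 * C1 + J3))"
    by (simp only: C1 a_def n_def)
  \<comment> \<open>As J1 \<le> J2, only J2 - J1 needs a bound; V/2 \<le> J3 links the energy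
    estimate with the gap J3 - J1.\<close>
  have "\<bar>J1 - J2\<bar> \<le> \<delta> * (2 / (\<theta> - \<delta>) * (\<theta>\<^sup>2 * C1 + J3) + \<beta>2\<^sup>2 * (L2_nrm y)\<^sup>2)"
    using J12 J2_le V_le gap by (simp add: distrib_left)
  then show ?thesis
    unfolding J1_def J2_def J3_def cost_fb[symmetric] unfolding z_def y_def .
qed

end
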